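(* For every finite matching market with independent types and downward-closed feasibility, the generalized seller-offering mechanism (GSOM) and the generalized buyer-offering mechanism (GBOM) are both DSIC, ex-post IR and ex-ante WBB, and $$2\,G_{\mathrm{offer}}\ge V_1 ,$$ where $G_{\mathrm{offer}}$ is the expected gains from trade when choosing between GSOM and GBOM with equal probability, independently of reports.
   Context: A finite matching market consists of finite disjoint sets of buyers and sellers, a set $E$ of compatible buyer–seller edges, and a nonempty family $\mathcal F$ of matchings of the bipartite graph that is downward-closed (subsets of members are members). Buyer $i$ has private value $v_i$ with support $b_i^1<\dots<b_i^{n_i}$ and probabilities $g_{i\ell}>0$; seller $j$ has private cost $c_j$ with support $s_j^1<\dots<s_j^{m_j}$ and probabilities $f_{jk}>0$; all types are independent. Virtual values and costs: $\phi_i(b_i^\ell)=b_i^\ell-(b_i^{\ell+1}-b_i^\ell)\frac{\sum_{r>\ell}g_{ir}}{g_{i\ell}}$ for $\ell<n_i$, $\phi_i(b_i^{n_i})=b_i^{n_i}$; $\tau_j(s_j^k)=s_j^k+(s_j^k-s_j^{k-1})\frac{\sum_{r<k}f_{jr}}{f_{jk}}$ for $k>1$, $\tau_j(s_j^1)=s_j^1$. Ironing a sequence of scores indexed by ordered types with positive weights: repeatedly merge adjacent blocks whose probability-weighted means violate monotonicity, assigning each block its weighted mean, until the block means are nondecreasing (equivalently, take slopes of the greatest convex minorant of the cumulative weighted score curve). $\bar\phi_i$, $\bar\tau_j$ are the ironed versions of $\phi_i$, $\tau_j$ (ironed separately). GSOM selects at each report profile a matching $M\in\mathcal F$ maximizing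 $\sum_{(i,j)\in M}(\bar\phi_i(v_i)-c_j)$; GBOM selects one maximizing $\sum_{(i,j)\in M}(v_i-\bar\tau_j(c_j))$. In both, among maximizers the cardinality is minimized and remaining ties are broken by a fixed report-independent order. Payments are finite-support threshold payments: given the others' reports, a trading buyer pays the smallest report in her support at which she trades, a trading seller receives the largest cost report in her support at which she trades; non-trading agents pay and receive nothing. For a mechanism with edge probabilities $x_{ij}$ and payments $p_a$ from agent $a$ to the mechanism (any sign), with $q_i=\sum_jx_{ij}$, $y_j=\sum_ix_{ij}$, buyer utility is $v_iq_i-p_i$, seller utility is $-c_jy_j-p_j$. DSIC: truthful reporting is optimal for each agent and type at every profile of others' reports. Ex-post IR: truthful utility is nonnegative at every profile. Ex-ante WBB: $\mathbb E[\sum_ap_a]\ge0$. BIC: truthful reporting maximizes each type's expected utility when others are truthful; IIR: expected truthful utility of each type is nonnegative. $\mathrm{GFT}=\mathbb E[\sum_{(i,j)\in E}(v_i-c_j)x_{ij}]$. $V_1$ is the maximum of $\mathrm{GFT}+\mathbb E[\sum_ap_a]$ over BIC, IIR mechanisms (lotteries over $\mathcal F$ at each report profile, payments unrestricted, no budget constraint). *)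

theory Defs
  imports "HOL-Probability.Product_PMF"
begin

section \<open>Finite matching markets\<close>

text \<open>
  Agents live in the sum type, buyer \<open>i\<close> as \<open>Inl i\<close> and seller \<open>j\<close> as \<open>Inr j\<close>, so buyers and
  sellers are disjoint by construction. A type of agent \<open>a\<close> is an index in \<open>{1..ntypes M a}\<close>;
  \<open>tval M a l\<close> is the value \<open>b\<^sub>i\<^sup>l\<close> (buyer) or the cost \<open>s\<^sub>j\<^sup>l\<close> (seller) at the \<open>l\<close>-th support point,
  and \<open>pmf (tdist M a) l\<close> is its probability \<open>g\<^sub>i\<^sub>l\<close> or \<open>f\<^sub>j\<^sub>l\<close>.
\<close>

record ('b, 's) market =
  buyers :: "'b set"
  sellers :: "'s set"
  edges :: "('b \<times> 's) set"
  feasible :: "('b \<times> 's) set set"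
  ntypes :: "'b + 's \<Rightarrow> nat"
  tval :: "'b + 's \<Rightarrow> nat \<Rightarrow> real"
  tdist :: "'b + 's \<Rightarrow> nat pmf"

definition agents :: "('b, 's) market \<Rightarrow> ('b + 's) set" where
  "agents M = buyers M <+> sellers M"

definition types :: "('b, 's) market \<Rightarrow> 'b + 's \<Rightarrow> nat set" where
  "types M a = {1..ntypes M a}"

definition is_matching :: "('b \<times> 's) set \<Rightarrow> ('b \<times> 's) set \<Rightarrow> bool" where
  "is_matching E X \<longleftrightarrow> X \<subseteq> E \<and> inj_on fst X \<and> inj_on snd X"

definition matching_market :: "('b, 's) market \<Rightarrow> bool" where
  "matching_market M \<longleftrightarrow>
     finite (buyers M) \<and> finite (sellers M) \<and>
     edges M \<subseteq> buyers M \<times> sellers M \<and>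
     feasible M \<noteq> {} \<and>
     (\<forall>X\<in>feasible M. is_matching (edges M) X) \<and>
     (\<forall>X\<in>feasible M. \<forall>Y. Y \<subseteq> X \<longrightarrow> Y \<in> feasible M) \<and>
     (\<forall>a\<in>agents M. set_pmf (tdist M a) = types M a \<and> strict_mono_on (types M a) (tval M a))"

type_synonym ('b, 's) profile = "'b + 's \<Rightarrow> nat"

text \<open>A profile takes the dummy value \<open>0\<close> outside the set of agents, as the product pmf
  \<^const>\<open>Pi_pmf\<close> (independence of the types) requires.\<close>

definition profiles :: "('b, 's) market \<Rightarrow> ('b, 's) profile set" where
  "profiles M = PiE_dflt (agents M) 0 (types M)"

definition prior :: "('b, 's) market \<Rightarrow> ('b, 's) profile pmf" where
  "prior M = Pi_pmf (agents M) 0 (tdist M)"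

abbreviation expect :: "('b, 's) market \<Rightarrow> (('b, 's) profile \<Rightarrow> real) \<Rightarrow> real" where
  "expect M \<equiv> measure_pmf.expectation (prior M)"


section \<open>Virtual values and costs, ironing\<close>

definition virtual_value :: "('b, 's) market \<Rightarrow> 'b \<Rightarrow> nat \<Rightarrow> real" where
  "virtual_value M i l =
     (let n = ntypes M (Inl i); b = tval M (Inl i); g = pmf (tdist M (Inl i))
      in if l < n then b l - (b (l + 1) - b l) * ((\<Sum>r\<in>{l<..n}. g r) / g l) else b l)"

definition virtual_cost :: "('b, 's) market \<Rightarrow> 's \<Rightarrow> nat \<Rightarrow> real" where
  "virtual_cost M j k =
     (let s = tval M (Inr j); f = pmf (tdist M (Inr j))
      in if k > 1 then s k + (s k - s (k - 1)) * ((\<Sum>r\<in>{1..<k}. f r) / f k) else s k)"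

text \<open>
  A block is a list of (score, weight) pairs of consecutive types. \<open>absorb blk bs\<close> puts \<open>blk\<close> in
  front of the block list \<open>bs\<close> and keeps merging while the two leading means are out of order;
  \<open>iron_blocks\<close> thus turns the singleton blocks, added from the right, into blocks with
  nondecreasing means. (The order in which violating neighbours are merged does not matter.)
\<close>

definition block_mean :: "(real \<times> real) list \<Rightarrow> real" where
  "block_mean blk = (\<Sum>(x, w)\<leftarrow>blk. w * x) / (\<Sum>(x, w)\<leftarrow>blk. w)"

fun absorb :: "(real \<times> real) list \<Rightarrow> (real \<times> real) list list \<Rightarrow> (real \<times> real) list list" where
  "absorb blk [] = [blk]"
| "absorb blk (c # cs) =
     (if block_mean blk > block_mean c then absorb (blk @ c) cs else blk # c # cs)"

fun iron_blocks :: "(real \<times> real) list \<Rightarrow> (real \<times> real) list list" where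
  "iron_blocks [] = []"
| "iron_blocks (p # ps) = absorb [p] (iron_blocks ps)"

definition iron :: "nat \<Rightarrow> (nat \<Rightarrow> real) \<Rightarrow> (nat \<Rightarrow> real) \<Rightarrow> nat \<Rightarrow> real" where
  "iron n w x k =
     concat (map (\<lambda>blk. replicate (length blk) (block_mean blk))
       (iron_blocks (map (\<lambda>l. (x l, w l)) [1..<Suc n]))) ! (k - 1)"

definition ironed_value :: "('b, 's) market \<Rightarrow> 'b \<Rightarrow> nat \<Rightarrow> real" where
  "ironed_value M i = iron (ntypes M (Inl i)) (pmf (tdist M (Inl i))) (virtual_value M i)"

definition ironed_cost :: "('b, 's) market \<Rightarrow> 's \<Rightarrow> nat \<Rightarrow> real" where
  "ironed_cost M j = iron (ntypes M (Inr j)) (pmf (tdist M (Inr j))) (virtual_cost M j)"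


section \<open>Mechanisms\<close>

text \<open>\<open>pay m t a\<close> is the payment, of either sign, from agent \<open>a\<close> to the mechanism.\<close>

record ('b, 's) mechanism =
  lottery :: "('b, 's) profile \<Rightarrow> ('b \<times> 's) set pmf"
  pay :: "('b, 's) profile \<Rightarrow> 'b + 's \<Rightarrow> real"

definition feasible_mechanism :: "('b, 's) market \<Rightarrow> ('b, 's) mechanism \<Rightarrow> bool" where
  "feasible_mechanism M m \<longleftrightarrow> (\<forall>t\<in>profiles M. set_pmf (lottery m t) \<subseteq> feasible M)"

definition edge_prob :: "('b, 's) mechanism \<Rightarrow> ('b, 's) profile \<Rightarrow> 'b \<Rightarrow> 's \<Rightarrow> real" where
  "edge_prob m t i j = measure_pmf.prob (lottery m t) {X. (i, j) \<in> X}"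

text \<open>\<open>utility M m a l t\<close>: utility of agent \<open>a\<close> with true type \<open>l\<close> when the reports are \<open>t\<close>.\<close>

fun utility ::
  "('b, 's) market \<Rightarrow> ('b, 's) mechanism \<Rightarrow> 'b + 's \<Rightarrow> nat \<Rightarrow> ('b, 's) profile \<Rightarrow> real" where
  "utility M m (Inl i) l t =
     tval M (Inl i) l * (\<Sum>j\<in>sellers M. edge_prob m t i j) - pay m t (Inl i)"
| "utility M m (Inr j) l t =
     - tval M (Inr j) l * (\<Sum>i\<in>buyers M. edge_prob m t i j) - pay m t (Inr j)"

definition dsic :: "('b, 's) market \<Rightarrow> ('b, 's) mechanism \<Rightarrow> bool" where
  "dsic M m \<longleftrightarrow> (\<forall>a\<in>agents M. \<forall>t\<in>profiles M. \<forall>r\<in>types M a.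
     utility M m a (t a) (t(a := r)) \<le> utility M m a (t a) t)"

definition ex_post_ir :: "('b, 's) market \<Rightarrow> ('b, 's) mechanism \<Rightarrow> bool" where
  "ex_post_ir M m \<longleftrightarrow> (\<forall>a\<in>agents M. \<forall>t\<in>profiles M. 0 \<le> utility M m a (t a) t)"

definition revenue :: "('b, 's) market \<Rightarrow> ('b, 's) mechanism \<Rightarrow> real" where
  "revenue M m = expect M (\<lambda>t. \<Sum>a\<in>agents M. pay m t a)"

definition ex_ante_wbb :: "('b, 's) market \<Rightarrow> ('b, 's) mechanism \<Rightarrow> bool" where
  "ex_ante_wbb M m \<longleftrightarrow> 0 \<le> revenue M m"

text \<open>
  Interim expected utility of agent \<open>a\<close> with true type \<open>l\<close> and report \<open>r\<close>, the others being
  truthful: the component \<open>a\<close> of the random profile is overwritten, and by independence the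
  others' types keep their prior distribution given the type of \<open>a\<close>.
\<close>

definition interim ::
  "('b, 's) market \<Rightarrow> ('b, 's) mechanism \<Rightarrow> 'b + 's \<Rightarrow> nat \<Rightarrow> nat \<Rightarrow> real" where
  "interim M m a l r = expect M (\<lambda>t. utility M m a l (t(a := r)))"

definition bic :: "('b, 's) market \<Rightarrow> ('b, 's) mechanism \<Rightarrow> bool" where
  "bic M m \<longleftrightarrow> (\<forall>a\<in>agents M. \<forall>l\<in>types M a. \<forall>r\<in>types M a. interim M m a l r \<le> interim M m a l l)"

definition iir :: "('b, 's) market \<Rightarrow> ('b, 's) mechanism \<Rightarrow> bool" where
  "iir M m \<longleftrightarrow> (\<forall>a\<in>agents M. \<forall>l\<in>types M a. 0 \<le> interim M m a l l)"

definition gft :: "('b, 's) market \<Rightarrow> ('b, 's) mechanism \<Rightarrow> real" where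
  "gft M m = expect M (\<lambda>t. \<Sum>(i, j)\<in>edges M.
     (tval M (Inl i) (t (Inl i)) - tval M (Inr j) (t (Inr j))) * edge_prob m t i j)"

text \<open>\<open>is_V1 M V\<close>: the maximum defining \<open>V\<^sub>1\<close> exists and equals \<open>V\<close>.\<close>

definition is_V1 :: "('b, 's) market \<Rightarrow> real \<Rightarrow> bool" where
  "is_V1 M V \<longleftrightarrow>
     (\<exists>m. feasible_mechanism M m \<and> bic M m \<and> iir M m \<and> gft M m + revenue M m = V) \<and>
     (\<forall>m. feasible_mechanism M m \<and> bic M m \<and> iir M m \<longrightarrow> gft M m + revenue M m \<le> V)"


section \<open>The offer mechanisms\<close>

definition score ::
  "('b \<Rightarrow> nat \<Rightarrow> real) \<Rightarrow> ('s \<Rightarrow> nat \<Rightarrow> real) \<Rightarrow> ('b, 's) profile \<Rightarrow> ('b \<times> 's) set \<Rightarrow> real" where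
  "score bs ss t X = (\<Sum>(i, j)\<in>X. bs i (t (Inl i)) - ss j (t (Inr j)))"

definition maximizers ::
  "('b, 's) market \<Rightarrow> ('b \<Rightarrow> nat \<Rightarrow> real) \<Rightarrow> ('s \<Rightarrow> nat \<Rightarrow> real) \<Rightarrow> ('b, 's) profile \<Rightarrow>
   ('b \<times> 's) set set" where
  "maximizers M bs ss t =
     {X \<in> feasible M. \<forall>Y\<in>feasible M. score bs ss t Y \<le> score bs ss t X}"

definition smallest :: "('b \<times> 's) set set \<Rightarrow> ('b \<times> 's) set set" where
  "smallest A = {X \<in> A. \<forall>Y\<in>A. card X \<le> card Y}"

text \<open>The tie-breaking order \<open>ord\<close> is a linear order on the feasible matchings; its least
  candidate is selected.\<close>

definition select ::
  "('b, 's) market \<Rightarrow> ('b \<times> 's) set rel \<Rightarrow> ('b \<Rightarrow> nat \<Rightarrow> real) \<Rightarrow> ('s \<Rightarrow> nat \<Rightarrow> real) \<Rightarrow>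
   ('b, 's) profile \<Rightarrow> ('b \<times> 's) set" where
  "select M ord bs ss t =
     (THE X. X \<in> smallest (maximizers M bs ss t) \<and>
             (\<forall>Y\<in>smallest (maximizers M bs ss t). (X, Y) \<in> ord))"

fun trades :: "('b \<times> 's) set \<Rightarrow> 'b + 's \<Rightarrow> bool" where
  "trades X (Inl i) \<longleftrightarrow> i \<in> fst ` X"
| "trades X (Inr j) \<longleftrightarrow> j \<in> snd ` X"

definition trade_reports ::
  "('b, 's) market \<Rightarrow> (('b, 's) profile \<Rightarrow> ('b \<times> 's) set) \<Rightarrow> ('b, 's) profile \<Rightarrow> 'b + 's \<Rightarrow>
   real set" where
  "trade_reports M sel t a = {tval M a r | r. r \<in> types M a \<and> trades (sel (t(a := r))) a}"

fun threshold_pay ::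
  "('b, 's) market \<Rightarrow> (('b, 's) profile \<Rightarrow> ('b \<times> 's) set) \<Rightarrow> ('b, 's) profile \<Rightarrow> 'b + 's \<Rightarrow>
   real" where
  "threshold_pay M sel t (Inl i) =
     (if trades (sel t) (Inl i) then Min (trade_reports M sel t (Inl i)) else 0)"
| "threshold_pay M sel t (Inr j) =
     (if trades (sel t) (Inr j) then - Max (trade_reports M sel t (Inr j)) else 0)"

definition threshold_mechanism ::
  "('b, 's) market \<Rightarrow> (('b, 's) profile \<Rightarrow> ('b \<times> 's) set) \<Rightarrow> ('b, 's) mechanism" where
  "threshold_mechanism M sel =
     \<lparr>lottery = \<lambda>t. return_pmf (sel t), pay = threshold_pay M sel\<rparr>"

definition gsom :: "('b, 's) market \<Rightarrow> ('b \<times> 's) set rel \<Rightarrow> ('b, 's) mechanism" where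
  "gsom M ord = threshold_mechanism M (select M ord (ironed_value M) (\<lambda>j. tval M (Inr j)))"

definition gbom :: "('b, 's) market \<Rightarrow> ('b \<times> 's) set rel \<Rightarrow> ('b, 's) mechanism" where
  "gbom M ord = threshold_mechanism M (select M ord (\<lambda>i. tval M (Inl i)) (ironed_cost M))"

definition G_offer ::
  "('b, 's) market \<Rightarrow> ('b \<times> 's) set rel \<Rightarrow> ('b \<times> 's) set rel \<Rightarrow> real" where
  "G_offer M rs rb = measure_pmf.expectation (bernoulli_pmf (1 / 2))
     (\<lambda>coin. gft M (if coin then gsom M rs else gbom M rb))"

end

theory Submission
  imports Defs
begin

text \<open>
  By summation by parts, the expected payment of an agent in a BIC and IIR mechanism is at most her
  expected virtual welfare, with equality for monotone threshold rules. Ironing a score can only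
  increase the welfare of a monotone allocation and does not change it if the allocation is constant
  on the level sets of the ironed score. Hence the threshold mechanism scoring each agent by the
  ironed sum of value and virtual value attains \<open>V\<^sub>1\<close>. Per edge, its objective before ironing is
  \<open>(\<phi>\<^sub>i - c\<^sub>j) + (v\<^sub>i - \<tau>\<^sub>j)\<close>; ironing bounds the two summands by the scores that GSOM and GBOM
  maximize, and the maximal scores are bounded by gains from trade because \<open>\<phi>\<^sub>i \<le> v\<^sub>i\<close> and
  \<open>\<tau>\<^sub>j \<ge> c\<^sub>j\<close>. Budget balance holds edge by edge: if the
  truthfully scored agent of a selected edge reports her threshold, the edge still has a nonnegative
  score, since otherwise dropping it would be better.
\<close>

section \<open>Ironing\<close>

text \<open>\<open>qs\<close> plays the role of an allocation, listed by type: this is its weighted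
  welfare under the raw scores minus its welfare when every score of the block is
  \<open>m\<close>.\<close>

definition excess :: "(real \<times> real) list \<Rightarrow> real \<Rightarrow> real list \<Rightarrow> real" where
  "excess blk m qs = (\<Sum>((x, w), q)\<leftarrow>zip blk qs. w * (x - m) * q)"

definition positive_weights :: "(real \<times> real) list \<Rightarrow> bool" where
  "positive_weights blk \<longleftrightarrow> (\<forall>(x, w)\<in>set blk. w > 0)"

text \<open>On a nonempty block with positive weights, summation by parts turns this into the
  statement that the cumulative weighted score curve lies on or above its chord.\<close>

definition dominated :: "(real \<times> real) list \<Rightarrow> bool" where
  "dominated blk \<longleftrightarrow>
     (\<forall>qs. length qs = length blk \<longrightarrow> sorted qs \<longrightarrow> excess blk (block_mean blk) qs \<le> 0)"

lemma excess_Nil [simp]: "excess [] m qs = 0"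
  by (simp add: excess_def)

lemma excess_Cons [simp]: "excess (p # blk) m (q # qs) = snd p * (fst p - m) * q + excess blk m qs"
  by (simp add: excess_def split_beta)

lemma excess_append:
  "length qs = length b \<Longrightarrow> excess (b @ c) m (qs @ rs) = excess b m qs + excess c m rs"
  by (simp add: excess_def)

lemma excess_change_mean:
  "length qs = length b \<Longrightarrow>
     excess b m qs = excess b m' qs + (m' - m) * (\<Sum>((x, w), q)\<leftarrow>zip b qs. w * q)"
  by (induction qs b rule: list_induct2) (auto simp: algebra_simps)

lemma excess_shift:
  "length qs = length b \<Longrightarrow>
     excess b m (map (\<lambda>q. q - \<theta>) qs) = excess b m qs - \<theta> * (\<Sum>(x, w)\<leftarrow>b. w * (x - m))"
  by (induction qs b rule: list_induct2) (auto simp: algebra_simps)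

lemma weight_pos:
  assumes "positive_weights b" "b \<noteq> []"
  shows "(\<Sum>(x, w)\<leftarrow>b. w) > 0"
  using assms
proof (induction b)
  case (Cons p b)
  then show ?case by (cases "b = []") (auto simp: positive_weights_def)
qed simp

lemma weight_times_mean:
  assumes "positive_weights b" "b \<noteq> []"
  shows "(\<Sum>(x, w)\<leftarrow>b. w) * block_mean b = (\<Sum>(x, w)\<leftarrow>b. w * x)"
  using weight_pos[OF assms] by (simp add: block_mean_def)

lemma deviation_eq: "(\<Sum>(x, w)\<leftarrow>b. w * (x - m)) = (\<Sum>(x, w)\<leftarrow>b. w * x) - (\<Sum>(x, w)\<leftarrow>b. w) * m" for m :: real
  by (induction b) (auto simp: algebra_simps)

lemma positive_weights_append [simp]:
  "positive_weights (b @ c) \<longleftrightarrow> positive_weights b \<and> positive_weights c"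
  by (auto simp: positive_weights_def)

text \<open>The mean of the concatenation is the average of the two means, weighted by the total
  weights.\<close>

lemma block_mean_append:
  assumes "positive_weights b" "positive_weights c" "b \<noteq> []" "c \<noteq> []"
    and "block_mean c \<le> block_mean b"
  shows "block_mean c \<le> block_mean (b @ c)" "block_mean (b @ c) \<le> block_mean b"
proof -
  define B C where "B = (\<Sum>(x, w)\<leftarrow>b. w)" and "C = (\<Sum>(x, w)\<leftarrow>c. w)"
  have BC: "B > 0" "C > 0"
    using assms weight_pos by (auto simp: B_def C_def)
  have m: "block_mean (b @ c) = (B * block_mean b + C * block_mean c) / (B + C)"
    using weight_times_mean[of b] weight_times_mean[of c] assms
    by (simp add: block_mean_def[of "b @ c"] B_def C_def)
  have "C * block_mean c \<le> C * block_mean b" "B * block_mean c \<le> B * block_mean b"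
    using BC assms by auto
  then show "block_mean c \<le> block_mean (b @ c)" "block_mean (b @ c) \<le> block_mean b"
    using BC unfolding m by (auto simp: field_simps)
qed

lemma weighted_sum_nonneg:
  assumes "positive_weights b" "\<And>q. q \<in> set qs \<Longrightarrow> 0 \<le> q"
  shows "(\<Sum>((x, w), q)\<leftarrow>zip b qs. w * q) \<ge> (0::real)"
proof (rule sum_list_nonneg)
  fix y assume "y \<in> set (map (\<lambda>((x, w), q). w * q) (zip b qs))"
  then obtain x w q where "((x, w), q) \<in> set (zip b qs)" "y = w * q"
    by auto
  moreover then have "(x, w) \<in> set b" "q \<in> set qs"
    by (auto dest: set_zip_leftD set_zip_rightD)
  ultimately show "0 \<le> y"
    using assms by (fastforce simp: positive_weights_def)
qed

lemma weighted_sum_nonpos: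
  assumes "positive_weights b" "\<And>q. q \<in> set qs \<Longrightarrow> q \<le> 0"
  shows "(\<Sum>((x, w), q)\<leftarrow>zip b qs. w * q) \<le> (0::real)"
proof (rule sum_list_nonpos)
  fix y assume "y \<in> set (map (\<lambda>((x, w), q). w * q) (zip b qs))"
  then obtain x w q where "((x, w), q) \<in> set (zip b qs)" "y = w * q"
    by auto
  moreover then have "(x, w) \<in> set b" "q \<in> set qs"
    by (auto dest: set_zip_leftD set_zip_rightD)
  ultimately show "y \<le> 0"
    using assms by (fastforce simp: positive_weights_def mult_le_0_iff)
qed

text \<open>Both sides of the claim are unchanged when a constant \<open>\<theta>\<close> is subtracted from the test
  sequence; choosing \<open>\<theta>\<close> at the seam makes it nonpositive on \<open>b\<close> and nonnegative on \<open>c\<close>, so moving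
  the two means towards the common one only decreases the sum.\<close>

lemma dominated_append:
  assumes "positive_weights b" "positive_weights c" "b \<noteq> []" "c \<noteq> []"
    and "dominated b" "dominated c" "block_mean c \<le> block_mean b"
  shows "dominated (b @ c)"
  unfolding dominated_def
proof (intro allI impI)
  fix qs :: "real list"
  assume len: "length qs = length (b @ c)" and sorted: "sorted qs"
  define \<theta> where "\<theta> = qs ! length b"
  define m where "m = block_mean (b @ c)"
  define rs where "rs = map (\<lambda>q. q - \<theta>) qs"
  define r1 r2 where "r1 = take (length b) rs" and "r2 = drop (length b) rs"
  have l1: "length r1 = length b" and l2: "length r2 = length c" and rs: "rs = r1 @ r2"
    using len by (auto simp: r1_def r2_def rs_def)
  have lt: "length b < length qs"
    using len assms by auto
  have neg: "r \<le> 0" if r: "r \<in> set r1" for r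
  proof -
    obtain k where "k < length b" "r = r1 ! k"
      using r l1 by (metis in_set_conv_nth)
    then have "k < length b" "r = rs ! k"
      by (simp_all add: r1_def)
    then show ?thesis
      using sorted_nth_mono[OF sorted, of k "length b"] lt by (simp add: rs_def \<theta>_def)
  qed
  have pos: "0 \<le> r" if r: "r \<in> set r2" for r
  proof -
    obtain k where "k < length c" "r = r2 ! k"
      using r l2 by (metis in_set_conv_nth)
    then have "k < length c" "r = rs ! (length b + k)"
      using len by (auto simp: r2_def rs_def)
    then show ?thesis
      using sorted_nth_mono[OF sorted, of "length b" "length b + k"] len
      by (simp add: rs_def \<theta>_def)
  qed
  have "sorted rs"
    using sorted by (auto simp: rs_def sorted_iff_nth_mono)
  then have "sorted r1" "sorted r2"
    by (auto simp: r1_def r2_def sorted_wrt_take sorted_wrt_drop)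
  then have dom: "excess b (block_mean b) r1 \<le> 0" "excess c (block_mean c) r2 \<le> 0"
    using assms l1 l2 by (auto simp: dominated_def)
  have m: "block_mean c \<le> m" "m \<le> block_mean b"
    using block_mean_append[of b c] assms by (auto simp: m_def)
  have "(block_mean b - m) * (\<Sum>((x, w), q)\<leftarrow>zip b r1. w * q) \<le> 0"
    using weighted_sum_nonpos[of b r1] assms neg m by (intro mult_nonneg_nonpos) auto
  moreover have "(block_mean c - m) * (\<Sum>((x, w), q)\<leftarrow>zip c r2. w * q) \<le> 0"
    using weighted_sum_nonneg[of c r2] assms pos m by (intro mult_nonpos_nonneg) auto
  ultimately have "excess b m r1 + excess c m r2 \<le> 0"
    using excess_change_mean[OF l1, of m "block_mean b"]
      excess_change_mean[OF l2, of m "block_mean c"] dom by linarith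
  then have "excess (b @ c) m rs \<le> 0"
    by (simp add: rs excess_append l1)
  moreover have "(\<Sum>(x, w)\<leftarrow>b @ c. w * (x - m)) = 0"
    using weight_times_mean[of "b @ c"] assms unfolding deviation_eq m_def by simp
  ultimately show "excess (b @ c) (block_mean (b @ c)) qs \<le> 0"
    using excess_shift[OF len, of m \<theta>] by (simp add: rs_def m_def)
qed

section \<open>Invariant of the merging procedure\<close>

definition ironed_blocks :: "(real \<times> real) list list \<Rightarrow> bool" where
  "ironed_blocks bs \<longleftrightarrow>
     (\<forall>b\<in>set bs. b \<noteq> [] \<and> positive_weights b \<and> dominated b) \<and> sorted (map block_mean bs)"

lemma concat_absorb: "concat (absorb b cs) = b @ concat cs"
  by (induction b cs rule: absorb.induct) auto

text \<open>A merge happens exactly when the left mean exceeds the right one, which is the situation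
  of \<open>dominated_append\<close>; once merging stops, the new block has a mean at most that of
  its right neighbour, so the means stay sorted.\<close>

lemma ironed_blocks_absorb:
  assumes "ironed_blocks cs" "b \<noteq> []" "positive_weights b" "dominated b"
  shows "ironed_blocks (absorb b cs)"
  using assms
proof (induction b cs rule: absorb.induct)
  case (2 b c cs)
  have cs: "ironed_blocks cs" and c: "c \<noteq> []" "positive_weights c" "dominated c"
    and sorted: "sorted (map block_mean (c # cs))"
    using 2(2) by (auto simp: ironed_blocks_def)
  show ?case
  proof (cases "block_mean b > block_mean c")
    case True
    then have "dominated (b @ c)"
      using 2(3-) c by (simp add: dominated_append)
    then show ?thesis
      using True 2 cs c by simp
  next
    case False
    then have "sorted (map block_mean (b # c # cs))"
      using sorted by auto
    then show ?thesis
      using 2(2-) False by (simp add: ironed_blocks_def)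
  qed
qed (simp add: ironed_blocks_def)

lemma concat_iron_blocks: "concat (iron_blocks ps) = ps"
  by (induction ps) (auto simp: concat_absorb)

lemma ironed_blocks_iron_blocks:
  assumes "positive_weights ps"
  shows "ironed_blocks (iron_blocks ps)"
  using assms
proof (induction ps)
  case (Cons p ps)
  \<comment> \<open>A single score equals its mean, so its excess is zero.\<close>
  have "dominated [p]"
    using Cons.prems
    by (auto simp: dominated_def length_Suc_conv block_mean_def positive_weights_def)
  then show ?case
    using Cons by (auto simp: positive_weights_def intro!: ironed_blocks_absorb)
qed (simp add: ironed_blocks_def)

section \<open>The ironed sequence compared with the raw scores\<close>

definition ironed_list :: "(real \<times> real) list list \<Rightarrow> real list" where
  "ironed_list bs = concat (map (\<lambda>b. replicate (length b) (block_mean b)) bs)"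

lemma ironed_list_simps [simp]:
  "ironed_list [] = []"
  "ironed_list (b # bs) = replicate (length b) (block_mean b) @ ironed_list bs"
  by (simp_all add: ironed_list_def)

lemma length_ironed_list: "length (ironed_list bs) = length (concat bs)"
  by (induction bs) auto

lemma length_ironed_list_iron_blocks [simp]: "length (ironed_list (iron_blocks ps)) = length ps"
  by (simp add: length_ironed_list concat_iron_blocks del: length_concat)

lemma set_ironed_list: "set (ironed_list bs) \<subseteq> block_mean ` set bs"
  by (auto simp: ironed_list_def)

lemma sorted_ironed_list: "sorted (map block_mean bs) \<Longrightarrow> sorted (ironed_list bs)"
proof (induction bs)
  case (Cons b bs)
  then show ?case
    using set_ironed_list[of bs] by (auto simp: sorted_append)
qed simp

text \<open>Generalizes \<open>excess\<close> from one reference score to a list of them, so that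
  raw and ironed scores can be compared across several blocks.\<close>

definition scored_sum :: "(real \<times> real) list \<Rightarrow> real list \<Rightarrow> real list \<Rightarrow> real" where
  "scored_sum ps ys qs = (\<Sum>((x, w), y, q)\<leftarrow>zip ps (zip ys qs). w * (x - y) * q)"

lemma scored_sum_append:
  "length ys = length ps \<Longrightarrow> length qs = length ps \<Longrightarrow>
     scored_sum (ps @ ps') (ys @ ys') (qs @ qs') = scored_sum ps ys qs + scored_sum ps' ys' qs'"
  by (simp add: scored_sum_def)

lemma scored_sum_replicate:
  "length qs = length b \<Longrightarrow> scored_sum b (replicate (length b) m) qs = excess b m qs"
  by (induction qs b rule: list_induct2) (auto simp: scored_sum_def)

text \<open>The ironed score is the mean throughout a block, so each block contributes its
  \<open>excess\<close>, which domination makes nonpositive.\<close>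

lemma scored_sum_nonpos:
  "ironed_blocks bs \<Longrightarrow> sorted qs \<Longrightarrow> length qs = length (concat bs) \<Longrightarrow>
     scored_sum (concat bs) (ironed_list bs) qs \<le> 0"
proof (induction bs arbitrary: qs)
  case (Cons b bs)
  define q1 q2 where "q1 = take (length b) qs" and "q2 = drop (length b) qs"
  have q: "qs = q1 @ q2" "length q1 = length b" "length q2 = length (concat bs)"
    using Cons.prems by (auto simp: q1_def q2_def)
  then have s: "sorted q1" "sorted q2"
    using Cons.prems by (auto simp: sorted_append)
  have "scored_sum (concat bs) (ironed_list bs) q2 \<le> 0"
    using Cons q s by (intro Cons.IH) (auto simp: ironed_blocks_def)
  moreover have "excess b (block_mean b) q1 \<le> 0"
    using Cons.prems q s by (auto simp: ironed_blocks_def dominated_def)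
  ultimately show ?case
    using q by (simp add: scored_sum_append scored_sum_replicate)
qed (simp add: scored_sum_def)

lemma excess_replicate:
  "excess b m (replicate (length b) c) = c * (\<Sum>(x, w)\<leftarrow>b. w * (x - m))"
  by (induction b) (simp_all add: split_beta distrib_left ac_simps)

lemma excess_mean_replicate:
  assumes "positive_weights b" "b \<noteq> []"
  shows "excess b (block_mean b) (replicate (length b) c) = 0"
proof -
  have "(\<Sum>(x, w)\<leftarrow>b. w * (x - block_mean b)) = 0"
    unfolding deviation_eq using weight_times_mean[OF assms] by simp
  then show ?thesis
    by (simp add: excess_replicate)
qed

text \<open>A function of the ironed score is constant on each block, and deviations from a block
  mean have weighted sum zero.\<close>

lemma scored_sum_level_sets:
  "ironed_blocks bs \<Longrightarrow> scored_sum (concat bs) (ironed_list bs) (map f (ironed_list bs)) = 0"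
proof (induction bs)
  case (Cons b bs)
  then show ?case
    by (auto simp: scored_sum_append scored_sum_replicate excess_mean_replicate ironed_blocks_def)
qed (simp add: scored_sum_def)

lemma iron_eq_nth:
  "iron n w x k = ironed_list (iron_blocks (map (\<lambda>l. (x l, w l)) [1..<Suc n])) ! (k - 1)"
  by (simp add: iron_def ironed_list_def)

lemma iron_mono:
  assumes "\<And>k. k \<in> {1..n} \<Longrightarrow> w k > 0" "1 \<le> l" "l \<le> k" "k \<le> n"
  shows "iron n w x l \<le> iron n w x k"
proof -
  define ps where "ps = map (\<lambda>l. (x l, w l)) [1..<Suc n]"
  have "positive_weights ps"
    using assms(1) by (auto simp: positive_weights_def ps_def)
  then have "sorted (ironed_list (iron_blocks ps))"
    using ironed_blocks_iron_blocks by (auto simp: ironed_blocks_def intro: sorted_ironed_list)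
  then show ?thesis
    unfolding iron_eq_nth ps_def[symmetric]
    by (rule sorted_nth_mono) (use assms in \<open>simp_all add: ps_def del: upt_Suc\<close>)
qed

lemma sum_iron_eq_scored_sum:
  fixes x w q :: "nat \<Rightarrow> real" and n :: nat
  defines "ps \<equiv> map (\<lambda>l. (x l, w l)) [1..<Suc n]"
  shows "(\<Sum>k=1..n. w k * (x k - iron n w x k) * q k) =
    scored_sum ps (ironed_list (iron_blocks ps)) (map q [1..<Suc n])"
proof -
  have "scored_sum ps (ironed_list (iron_blocks ps)) (map q [1..<Suc n]) =
    (\<Sum>k<n. w (Suc k) * (x (Suc k) - iron n w x (Suc k)) * q (Suc k))"
    unfolding scored_sum_def sum_list_sum_nth iron_eq_nth ps_def[symmetric]
    by (rule sum.cong)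
      (simp_all add: ps_def atLeast0LessThan del: upt_Suc)
  also have "\<dots> = (\<Sum>k=1..n. w k * (x k - iron n w x k) * q k)"
    by (simp add: sum.atLeast1_atMost_eq)
  finally show ?thesis
    by simp
qed

lemma iron_dominates:
  fixes x w q :: "nat \<Rightarrow> real"
  assumes "\<And>k. k \<in> {1..n} \<Longrightarrow> w k > 0"
    and "\<And>l k. 1 \<le> l \<Longrightarrow> l \<le> k \<Longrightarrow> k \<le> n \<Longrightarrow> q l \<le> q k"
  shows "(\<Sum>k=1..n. w k * x k * q k) \<le> (\<Sum>k=1..n. w k * iron n w x k * q k)"
proof -
  define ps where "ps = map (\<lambda>l. (x l, w l)) [1..<Suc n]"
  have "positive_weights ps"
    using assms(1) by (auto simp: positive_weights_def ps_def)
  moreover have "sorted (map q [1..<Suc n])"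
    using assms(2) by (auto simp: sorted_iff_nth_mono simp del: upt_Suc)
  ultimately have "scored_sum ps (ironed_list (iron_blocks ps)) (map q [1..<Suc n]) \<le> 0"
    using scored_sum_nonpos[OF ironed_blocks_iron_blocks, of ps "map q [1..<Suc n]"]
    by (simp add: concat_iron_blocks ps_def)
  then show ?thesis
    unfolding sum_iron_eq_scored_sum[symmetric] ps_def
    by (simp add: algebra_simps sum_subtractf)
qed

lemma iron_eq_on_level_sets:
  fixes x w q :: "nat \<Rightarrow> real"
  assumes "\<And>k. k \<in> {1..n} \<Longrightarrow> w k > 0"
    and "\<And>l k. l \<in> {1..n} \<Longrightarrow> k \<in> {1..n} \<Longrightarrow> iron n w x l = iron n w x k \<Longrightarrow> q l = q k"
  shows "(\<Sum>k=1..n. w k * x k * q k) = (\<Sum>k=1..n. w k * iron n w x k * q k)"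
proof -
  define ps where "ps = map (\<lambda>l. (x l, w l)) [1..<Suc n]"
  define ys where "ys = ironed_list (iron_blocks ps)"
  \<comment> \<open>\<open>f\<close> reads the allocation off the ironed score; constancy on level
    sets makes the choice of \<open>k\<close> immaterial.\<close>
  define f where "f y = q (SOME k. k \<in> {1..n} \<and> iron n w x k = y)" for y
  have f: "f (iron n w x k) = q k" if k: "k \<in> {1..n}" for k
    unfolding f_def
  proof (rule someI2[where a = k])
    show "q l = q k" if "l \<in> {1..n} \<and> iron n w x l = iron n w x k" for l
      using that k by (intro assms(2)) simp_all
  qed (use k in simp)
  have "map q [1..<Suc n] = map f ys"
  proof (rule nth_equalityI)
    fix k assume "k < length (map q [1..<Suc n])"
    then show "map q [1..<Suc n] ! k = map f ys ! k"
      using f[of "Suc k"] unfolding iron_eq_nth ps_def[symmetric] ys_def[symmetric]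
      by (simp add: ys_def ps_def del: upt_Suc)
  qed (simp add: ys_def ps_def del: upt_Suc)
  moreover have "positive_weights ps"
    using assms(1) by (auto simp: positive_weights_def ps_def)
  ultimately have "scored_sum ps ys (map q [1..<Suc n]) = 0"
    using scored_sum_level_sets[OF ironed_blocks_iron_blocks, of ps f]
    by (simp add: concat_iron_blocks ys_def)
  then show ?thesis
    unfolding ys_def ps_def sum_iron_eq_scored_sum[symmetric]
    by (simp add: algebra_simps sum_subtractf)
qed

section \<open>Virtual values\<close>

lemma sum_split_tail: "k \<le> n \<Longrightarrow> (\<Sum>r\<in>{k..n}. g r) = g k + (\<Sum>r\<in>{k<..n}. g r)" for n :: nat
  by (rule sum.head)

text \<open>Summation by parts; index \<open>0\<close> is the option not to participate.\<close>

lemma virtual_value_sum: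
  fixes g v Q P :: "nat \<Rightarrow> real"
  assumes g: "\<And>l. l \<in> {1..n} \<Longrightarrow> g l > 0" and zero: "Q 0 = 0" "P 0 = 0"
  shows "(\<Sum>l=1..n. g l * ((v l - (v (l + 1) - v l) * ((\<Sum>r\<in>{l<..n}. g r) / g l)) * Q l - P l)) =
    (\<Sum>l=1..n. (\<Sum>r\<in>{l..n}. g r) * ((v l * Q l - P l) - (v l * Q (l - 1) - P (l - 1))))"
proof -
  define G where "G l = (\<Sum>r\<in>{l..n}. g r)" for l
  \<comment> \<open>Tail weight times the utility of type \<open>l\<close> from reporting
    \<open>l - 1\<close>. The telescoping sum vanishes: \<open>h 1\<close> is zero because index 0
    neither wins nor pays, \<open>h (Suc n)\<close> because the tail is empty.\<close>
  define h where "h l = G l * (v l * Q (l - 1) - P (l - 1))" for l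
  have "(\<Sum>l=1..n. h (Suc l) - h l) = h (Suc n) - h 1"
    by (rule sum_Suc_diff) simp
  also have "\<dots> = 0"
    by (simp add: h_def zero G_def)
  finally have h: "(\<Sum>l=1..n. h (Suc l) - h l) = 0" .
  have "g l * ((v l - (v (l + 1) - v l) * ((\<Sum>r\<in>{l<..n}. g r) / g l)) * Q l - P l) =
    G l * (v l * Q l - P l) - h (Suc l)" if "l \<in> {1..n}" for l
  proof -
    have "G l = g l + G (Suc l)"
      using sum_split_tail[of l n g] that by (simp add: G_def atLeastSucAtMost_greaterThanAtMost)
    moreover have "(\<Sum>r\<in>{l<..n}. g r) = G (Suc l)"
      by (simp add: G_def atLeastSucAtMost_greaterThanAtMost)
    ultimately show ?thesis
      using g[OF that] by (simp add: h_def field_simps)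
  qed
  then have "(\<Sum>l=1..n. g l * ((v l - (v (l + 1) - v l) * ((\<Sum>r\<in>{l<..n}. g r) / g l)) * Q l - P l)) =
    (\<Sum>l=1..n. G l * (v l * Q l - P l) - h (Suc l))"
    by (intro sum.cong) auto
  also have "\<dots> = (\<Sum>l=1..n. G l * (v l * Q l - P l) - h l)"
    using h by (simp add: sum_subtractf)
  finally show ?thesis
    by (simp add: G_def h_def algebra_simps)
qed

text \<open>Mirror image of \<open>virtual_value_sum\<close>: higher costs are worse types, so
  initial segments replace tails and the outside option sits at \<open>Suc n\<close>.\<close>

lemma virtual_cost_sum:
  fixes f s Q P :: "nat \<Rightarrow> real"
  assumes f: "\<And>k. k \<in> {1..n} \<Longrightarrow> f k > 0" and zero: "Q (Suc n) = 0" "P (Suc n) = 0"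
  shows "(\<Sum>k=1..n. f k * (- (s k + (s k - s (k - 1)) * ((\<Sum>r\<in>{1..<k}. f r) / f k)) * Q k - P k)) =
    (\<Sum>k=1..n. (\<Sum>r\<in>{1..k}. f r) * ((- s k * Q k - P k) - (- s k * Q (k + 1) - P (k + 1))))"
proof -
  define F where "F k = (\<Sum>r\<in>{1..<k}. f r)" for k
  define h where "h k = F k * (- s (k - 1) * Q k - P k)" for k
  have "(\<Sum>k=1..n. h (Suc k) - h k) = h (Suc n) - h 1"
    by (rule sum_Suc_diff) simp
  also have "\<dots> = 0"
    by (simp add: h_def zero F_def)
  finally have h: "(\<Sum>k=1..n. h (Suc k) - h k) = 0" .
  have "f k * (- (s k + (s k - s (k - 1)) * ((\<Sum>r\<in>{1..<k}. f r) / f k)) * Q k - P k) =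
    F (Suc k) * (- s k * Q k - P k) - h k" if "k \<in> {1..n}" for k
  proof -
    have "F (Suc k) = f k + F k"
      using that by (simp add: F_def)
    then show ?thesis
      using f[OF that] unfolding F_def[symmetric] by (simp add: h_def field_simps)
  qed
  then have "(\<Sum>k=1..n. f k * (- (s k + (s k - s (k - 1)) * ((\<Sum>r\<in>{1..<k}. f r) / f k)) * Q k - P k)) =
    (\<Sum>k=1..n. F (Suc k) * (- s k * Q k - P k) - h k)"
    by (intro sum.cong) auto
  also have "\<dots> = (\<Sum>k=1..n. F (Suc k) * (- s k * Q k - P k) - h (Suc k))"
    using h by (simp add: sum_subtractf)
  finally show ?thesis
    by (simp add: F_def h_def algebra_simps atLeastLessThanSuc_atLeastAtMost)
qed

section \<open>Signed agents\<close>

text \<open>A seller is treated as a buyer whose value for trading is minus her cost, so that both sides of the market obey the same inequalities.\<close>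

definition dir :: "'b + 's \<Rightarrow> real" where
  "dir a = (case a of Inl i \<Rightarrow> 1 | Inr j \<Rightarrow> - 1)"

definition signed_value :: "('b, 's) market \<Rightarrow> 'b + 's \<Rightarrow> nat \<Rightarrow> real" where
  "signed_value M a l = dir a * tval M a l"

definition signed_virtual :: "('b, 's) market \<Rightarrow> 'b + 's \<Rightarrow> nat \<Rightarrow> real" where
  "signed_virtual M a l = (case a of Inl i \<Rightarrow> virtual_value M i l | Inr j \<Rightarrow> - virtual_cost M j l)"

text \<open>\<open>iron\<close> makes scores nondecreasing in the type index, whereas signed values
  of a seller fall along the index; hence the sign is flipped before and after ironing.\<close>

definition signed_iron ::
  "('b, 's) market \<Rightarrow> ('b + 's \<Rightarrow> nat \<Rightarrow> real) \<Rightarrow> 'b + 's \<Rightarrow> nat \<Rightarrow> real" where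
  "signed_iron M x a l = dir a * iron (ntypes M a) (pmf (tdist M a)) (\<lambda>k. dir a * x a k) l"

text \<open>The neighbouring type with the next lower signed value. At the worst type it leaves
  \<open>types M a\<close>, which stands for staying out.\<close>

definition worse :: "'b + 's \<Rightarrow> nat \<Rightarrow> nat" where
  "worse a l = (case a of Inl i \<Rightarrow> l - 1 | Inr j \<Rightarrow> l + 1)"

definition trade_prob ::
  "('b, 's) market \<Rightarrow> ('b, 's) mechanism \<Rightarrow> ('b, 's) profile \<Rightarrow> 'b + 's \<Rightarrow> real" where
  "trade_prob M m t a = (case a of
     Inl i \<Rightarrow> \<Sum>j\<in>sellers M. edge_prob m t i j
   | Inr j \<Rightarrow> \<Sum>i\<in>buyers M. edge_prob m t i j)"

definition agent_welfare ::
  "('b, 's) market \<Rightarrow> ('b, 's) mechanism \<Rightarrow> ('b + 's \<Rightarrow> nat \<Rightarrow> real) \<Rightarrow> 'b + 's \<Rightarrow> real" where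
  "agent_welfare M m \<alpha> a = expect M (\<lambda>t. \<alpha> a (t a) * trade_prob M m t a)"

definition interim_prob ::
  "('b, 's) market \<Rightarrow> ('b, 's) mechanism \<Rightarrow> 'b + 's \<Rightarrow> nat \<Rightarrow> real" where
  "interim_prob M m a l = expect M (\<lambda>t. trade_prob M m (t(a := l)) a)"

definition interim_pay ::
  "('b, 's) market \<Rightarrow> ('b, 's) mechanism \<Rightarrow> 'b + 's \<Rightarrow> nat \<Rightarrow> real" where
  "interim_pay M m a l = expect M (\<lambda>t. pay m (t(a := l)) a)"

lemma dir_square [simp]: "dir a * (dir a * x) = x"
  by (cases a) (auto simp: dir_def)

lemma utility_eq: "utility M m a l t = signed_value M a l * trade_prob M m t a - pay m t a"
  by (cases a) (auto simp: signed_value_def dir_def trade_prob_def)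

section \<open>Profiles, expectations and independence of types\<close>

locale market =
  fixes M :: "('b, 's) market"
  assumes matching_market: "matching_market M"
begin

lemma finite_agents [simp, intro]: "finite (agents M)"
  using matching_market by (auto simp: matching_market_def agents_def)

lemma set_pmf_tdist: "a \<in> agents M \<Longrightarrow> set_pmf (tdist M a) = types M a"
  using matching_market by (auto simp: matching_market_def)

lemma finite_types [simp, intro]: "finite (types M a)"
  by (simp add: types_def)

lemma tval_less: "a \<in> agents M \<Longrightarrow> l \<in> types M a \<Longrightarrow> r \<in> types M a \<Longrightarrow>
    tval M a l < tval M a r \<longleftrightarrow> l < r"
  using matching_market
  by (metis matching_market_def strict_mono_on_less)

lemma tval_le: "a \<in> agents M \<Longrightarrow> l \<in> types M a \<Longrightarrow> r \<in> types M a \<Longrightarrow>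
    tval M a l \<le> tval M a r \<longleftrightarrow> l \<le> r"
  using tval_less[of a r l] by (simp flip: not_less)

lemma signed_value_le: "a \<in> agents M \<Longrightarrow> l \<in> types M a \<Longrightarrow> r \<in> types M a \<Longrightarrow>
    signed_value M a l \<le> signed_value M a r \<longleftrightarrow> (if isl a then l \<le> r else r \<le> l)"
  using tval_le[of a l r] tval_le[of a r l]
  by (cases a) (auto simp: signed_value_def dir_def)

lemma pmf_pos: "a \<in> agents M \<Longrightarrow> l \<in> types M a \<Longrightarrow> 0 < pmf (tdist M a) l"
  using set_pmf_tdist[of a] by (auto simp: pmf_positive_iff)

lemma profile_fun_upd: "t \<in> profiles M \<Longrightarrow> a \<in> agents M \<Longrightarrow> l \<in> types M a \<Longrightarrow> t(a := l) \<in> profiles M"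
  by (auto simp: profiles_def PiE_dflt_def)

lemma profile_types: "t \<in> profiles M \<Longrightarrow> a \<in> agents M \<Longrightarrow> t a \<in> types M a"
  by (auto simp: profiles_def PiE_dflt_def)

lemma set_pmf_prior: "set_pmf (prior M) = profiles M"
  unfolding prior_def set_Pi_pmf[OF finite_agents] profiles_def
  using set_pmf_tdist by (auto simp: PiE_dflt_def)

lemma finite_profiles: "finite (profiles M)"
  by (auto simp: profiles_def)

lemma integrable_prior [simp, intro]: "integrable (measure_pmf (prior M)) (f :: _ \<Rightarrow> real)"
  by (rule integrable_measure_pmf_finite) (simp add: set_pmf_prior finite_profiles)

lemma expect_mono: "(\<And>t. t \<in> profiles M \<Longrightarrow> f t \<le> g t) \<Longrightarrow> expect M f \<le> expect M g"
  by (rule integral_mono_AE) (auto simp: AE_measure_pmf_iff set_pmf_prior)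

lemma expect_cong: "(\<And>t. t \<in> profiles M \<Longrightarrow> f t = g t) \<Longrightarrow> expect M f = expect M g"
  by (rule integral_cong_AE) (auto simp: AE_measure_pmf_iff set_pmf_prior)

lemma expect_sum: "expect M (\<lambda>t. \<Sum>a\<in>A. f a t) = (\<Sum>a\<in>A. expect M (f a))"
  by (rule Bochner_Integration.integral_sum) auto

text \<open>Independence of the types: the component of one agent may be redrawn.\<close>

lemma expect_resample:
  assumes a: "a \<in> agents M"
  shows "expect M f = (\<Sum>l\<in>types M a. pmf (tdist M a) l * expect M (\<lambda>t. f (t(a := l))))"
proof -
  define R where "R = Pi_pmf (agents M - {a}) 0 (tdist M)"
  have prior: "prior M = tdist M a \<bind> (\<lambda>l. map_pmf (\<lambda>t. t(a := l)) R)"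
    using Pi_pmf_insert'[of "agents M - {a}" a 0 "tdist M"] a
    by (simp add: prior_def R_def insert_absorb map_pmf_def)
  \<comment> \<open>Of two successive overwrites at \<open>a\<close> only the second survives, so
    \<open>prior M\<close> can replace \<open>R\<close> under an overwrite.\<close>
  have redraw: "map_pmf (\<lambda>t. t(a := l)) (prior M) = map_pmf (\<lambda>t. t(a := l)) R" for l
    by (simp add: prior map_bind_pmf map_pmf_comp)
  have "finite (PiE_dflt (agents M - {a}) 0 (set_pmf \<circ> tdist M))"
    using set_pmf_tdist by (intro finite_PiE_dflt) auto
  then have "finite (set_pmf R)"
    by (simp add: R_def set_Pi_pmf)
  then have "expect M f =
      (\<Sum>l\<in>types M a. pmf (tdist M a) l * measure_pmf.expectation (map_pmf (\<lambda>t. t(a := l)) R) f)"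
    unfolding prior using set_pmf_tdist[OF a] by (subst pmf_expectation_bind) auto
  then show ?thesis
    by (simp flip: redraw)
qed

section \<open>Interim quantities, expected payments and virtual welfare\<close>

lemma agent_welfare_eq:
  assumes "a \<in> agents M"
  shows "agent_welfare M m \<alpha> a =
    (\<Sum>l\<in>types M a. pmf (tdist M a) l * \<alpha> a l * interim_prob M m a l)"
  unfolding agent_welfare_def interim_prob_def
  by (subst expect_resample[OF assms]) (simp add: mult.assoc)

lemma expect_pay_eq:
  assumes "a \<in> agents M"
  shows "expect M (\<lambda>t. pay m t a) = (\<Sum>l\<in>types M a. pmf (tdist M a) l * interim_pay M m a l)"
  unfolding interim_pay_def by (subst expect_resample[OF assms]) simp

lemma interim_eq:
  "interim M m a l r = signed_value M a l * interim_prob M m a r - interim_pay M m a r"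
  unfolding interim_def utility_eq interim_prob_def interim_pay_def
  by (subst Bochner_Integration.integral_diff) auto

text \<open>Common form of the two summations by parts. The weight \<open>G l\<close> used is the
  probability of a type at least as good as \<open>l\<close>.\<close>

lemma signed_virtual_sum:
  assumes a: "a \<in> agents M"
  obtains G :: "nat \<Rightarrow> real" where "\<And>l. 0 \<le> G l"
    and "(\<Sum>l\<in>types M a. pmf (tdist M a) l * (signed_virtual M a l * Q l - P l)) =
      (\<Sum>l\<in>types M a. G l * (signed_value M a l * Q l - P l -
        (if worse a l \<in> types M a
         then signed_value M a l * Q (worse a l) - P (worse a l) else 0)))"
proof -
  define n where "n = ntypes M a"
  define g where "g = pmf (tdist M a)"
  \<comment> \<open>Extension by zero turns the index just beyond the worst type into the outside
    option that the summation lemmas ask for.\<close>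
  define Q' where "Q' l = (if l \<in> types M a then Q l else 0)" for l
  define P' where "P' l = (if l \<in> types M a then P l else 0)" for l
  have g: "g l > 0" if "l \<in> {1..n}" for l
    using that pmf_pos[OF a] by (simp add: g_def n_def types_def)
  show thesis
  proof (cases a)
    case (Inl i)
    \<comment> \<open>At the top type the tail sum is empty, so the case distinction in
      \<open>virtual_value\<close> collapses into one formula.\<close>
    have virt: "signed_virtual M a l =
        tval M a l - (tval M a (l + 1) - tval M a l) * ((\<Sum>r\<in>{l<..n}. g r) / g l)"
      if "l \<in> {1..n}" for l
      using that by (auto simp: signed_virtual_def Inl virtual_value_def Let_def g_def n_def)
    have "(\<Sum>l=1..n. g l * (signed_virtual M a l * Q l - P l)) =
        (\<Sum>l=1..n. g l * ((tval M a l - (tval M a (l + 1) - tval M a l) *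
           ((\<Sum>r\<in>{l<..n}. g r) / g l)) * Q' l - P' l))"
      using virt by (intro sum.cong) (simp_all add: Q'_def P'_def types_def n_def)
    also have "\<dots> = (\<Sum>l=1..n. (\<Sum>r\<in>{l..n}. g r) *
        ((tval M a l * Q' l - P' l) - (tval M a l * Q' (l - 1) - P' (l - 1))))"
      by (rule virtual_value_sum[OF g]) (auto simp: Q'_def P'_def types_def)
    also have "\<dots> = (\<Sum>l=1..n. (\<Sum>r\<in>{l..n}. g r) * (signed_value M a l * Q l - P l -
        (if worse a l \<in> types M a
         then signed_value M a l * Q (worse a l) - P (worse a l) else 0)))"
      by (intro sum.cong)
        (auto simp: Q'_def P'_def types_def n_def Inl worse_def signed_value_def dir_def)
    finally show thesis
      by (intro that[of "\<lambda>l. \<Sum>r\<in>{l..n}. g r"]) (auto simp: types_def n_def g_def sum_nonneg)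
  next
    case (Inr j)
    have virt: "signed_virtual M a l =
        - (tval M a l + (tval M a l - tval M a (l - 1)) * ((\<Sum>r\<in>{1..<l}. g r) / g l))"
      if "l \<in> {1..n}" for l
      using that by (auto simp: signed_virtual_def Inr virtual_cost_def Let_def g_def n_def)
    have "(\<Sum>l=1..n. g l * (signed_virtual M a l * Q l - P l)) =
        (\<Sum>l=1..n. g l * (- (tval M a l + (tval M a l - tval M a (l - 1)) *
           ((\<Sum>r\<in>{1..<l}. g r) / g l)) * Q' l - P' l))"
      using virt by (intro sum.cong) (simp_all add: Q'_def P'_def types_def n_def)
    also have "\<dots> = (\<Sum>l=1..n. (\<Sum>r\<in>{1..l}. g r) *
        ((- tval M a l * Q' l - P' l) - (- tval M a l * Q' (l + 1) - P' (l + 1))))"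
      by (rule virtual_cost_sum[OF g]) (auto simp: Q'_def P'_def types_def n_def)
    also have "\<dots> = (\<Sum>l=1..n. (\<Sum>r\<in>{1..l}. g r) * (signed_value M a l * Q l - P l -
        (if worse a l \<in> types M a
         then signed_value M a l * Q (worse a l) - P (worse a l) else 0)))"
      by (intro sum.cong)
        (auto simp: Q'_def P'_def types_def n_def Inr worse_def signed_value_def dir_def)
    finally show thesis
      by (intro that[of "\<lambda>l. \<Sum>r\<in>{1..l}. g r"]) (auto simp: types_def n_def g_def sum_nonneg)
  qed
qed

text \<open>Each bracket is the slack of the incentive constraint of \<open>l\<close> against the
  next worse type, or of her participation constraint if \<open>l\<close> is the worst. Nonnegative
  slacks bound the payment; binding constraints determine it.\<close>

lemma welfare_minus_pay:
  assumes a: "a \<in> agents M"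
  obtains G :: "nat \<Rightarrow> real" where "\<And>l. 0 \<le> G l"
    and "agent_welfare M m (signed_virtual M) a - expect M (\<lambda>t. pay m t a) =
      (\<Sum>l\<in>types M a. G l * (interim M m a l l -
        (if worse a l \<in> types M a then interim M m a l (worse a l) else 0)))"
proof -
  have "agent_welfare M m (signed_virtual M) a - expect M (\<lambda>t. pay m t a) =
    (\<Sum>l\<in>types M a. pmf (tdist M a) l *
       (signed_virtual M a l * interim_prob M m a l - interim_pay M m a l))"
    unfolding agent_welfare_eq[OF a] expect_pay_eq[OF a]
    by (simp add: algebra_simps flip: sum_subtractf)
  moreover have "\<exists>G :: nat \<Rightarrow> real. (\<forall>l. 0 \<le> G l) \<and>
      (\<Sum>l\<in>types M a. pmf (tdist M a) l *
        (signed_virtual M a l * interim_prob M m a l - interim_pay M m a l)) =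
      (\<Sum>l\<in>types M a. G l * (interim M m a l l -
        (if worse a l \<in> types M a then interim M m a l (worse a l) else 0)))"
    unfolding interim_eq
    by (rule signed_virtual_sum[OF a,
        where Q = "interim_prob M m a" and P = "interim_pay M m a"]) blast
  ultimately have "\<exists>G :: nat \<Rightarrow> real. (\<forall>l. 0 \<le> G l) \<and>
      agent_welfare M m (signed_virtual M) a - expect M (\<lambda>t. pay m t a) =
      (\<Sum>l\<in>types M a. G l * (interim M m a l l -
        (if worse a l \<in> types M a then interim M m a l (worse a l) else 0)))"
    by (simp only:)
  then show thesis
    using that by blast
qed

lemma pay_le_virtual_welfare:
  assumes a: "a \<in> agents M" and "bic M m" "iir M m"
  shows "expect M (\<lambda>t. pay m t a) \<le> agent_welfare M m (signed_virtual M) a"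
proof -
  obtain G where G: "\<And>l. 0 \<le> G l" and eq:
    "agent_welfare M m (signed_virtual M) a - expect M (\<lambda>t. pay m t a) =
      (\<Sum>l\<in>types M a. G l * (interim M m a l l -
        (if worse a l \<in> types M a then interim M m a l (worse a l) else 0)))"
    by (rule welfare_minus_pay[OF a, where m = m]) (rule that)
  have "0 \<le> interim M m a l l - (if worse a l \<in> types M a then interim M m a l (worse a l) else 0)"
    if "l \<in> types M a" for l
    using assms that by (auto simp: bic_def iir_def)
  then have "0 \<le> agent_welfare M m (signed_virtual M) a - expect M (\<lambda>t. pay m t a)"
    unfolding eq using G by (intro sum_nonneg) auto
  then show ?thesis
    by simp
qed

lemma pay_eq_virtual_welfare:
  assumes a: "a \<in> agents M"
    and "\<And>l. l \<in> types M a \<Longrightarrow>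
      interim M m a l l = (if worse a l \<in> types M a then interim M m a l (worse a l) else 0)"
  shows "expect M (\<lambda>t. pay m t a) = agent_welfare M m (signed_virtual M) a"
proof -
  obtain G :: "nat \<Rightarrow> real" where "\<And>l. 0 \<le> G l" and eq:
    "agent_welfare M m (signed_virtual M) a - expect M (\<lambda>t. pay m t a) =
      (\<Sum>l\<in>types M a. G l * (interim M m a l l -
        (if worse a l \<in> types M a then interim M m a l (worse a l) else 0)))"
    by (rule welfare_minus_pay[OF a, where m = m]) (rule that)
  have "agent_welfare M m (signed_virtual M) a - expect M (\<lambda>t. pay m t a) = 0"
    unfolding eq using assms(2) by (intro sum.neutral) auto
  then show ?thesis
    by simp
qed

text \<open>Adding the two incentive constraints between \<open>l\<close> and \<open>r\<close>
  cancels the payments and leaves a product of two differences.\<close>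

lemma interim_prob_mono:
  assumes "a \<in> agents M" "bic M m" "l \<in> types M a" "r \<in> types M a"
    and "signed_value M a l \<le> signed_value M a r"
  shows "interim_prob M m a l \<le> interim_prob M m a r"
proof (cases "signed_value M a l = signed_value M a r")
  case True
  then have "l = r"
    using signed_value_le[of a l r] signed_value_le[of a r l] assms by (auto split: if_splits)
  then show ?thesis
    by simp
next
  case False
  have "interim M m a l r \<le> interim M m a l l" "interim M m a r l \<le> interim M m a r r"
    using assms by (auto simp: bic_def)
  then have "(signed_value M a r - signed_value M a l) *
      (interim_prob M m a r - interim_prob M m a l) \<ge> 0"
    by (simp add: interim_eq algebra_simps)
  then show ?thesis
    using False assms by (simp add: zero_le_mult_iff)
qed

lemma signed_iron_mono:
  assumes "a \<in> agents M" "l \<in> types M a" "r \<in> types M a"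
    and "signed_value M a l \<le> signed_value M a r"
  shows "signed_iron M x a l \<le> signed_iron M x a r"
proof -
  have "iron (ntypes M a) (pmf (tdist M a)) y k \<le> iron (ntypes M a) (pmf (tdist M a)) y k'"
    if "k \<in> types M a" "k' \<in> types M a" "k \<le> k'" for y k k'
    using that pmf_pos[OF assms(1)] by (intro iron_mono) (auto simp: types_def)
  then show ?thesis
    using assms signed_value_le[of a l r]
    by (cases a) (auto simp: signed_iron_def dir_def)
qed

lemma welfare_le_ironed_welfare:
  assumes a: "a \<in> agents M" and "bic M m"
  shows "agent_welfare M m x a \<le> agent_welfare M m (signed_iron M x) a"
proof -
  \<comment> \<open>The score and the probability of a seller both change sign: their product stays,
    and the probability becomes nondecreasing along the index, as \<open>iron_dominates\<close>
    asks.\<close>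
  let ?g = "pmf (tdist M a)" and ?q = "\<lambda>l. dir a * interim_prob M m a l"
  have "(\<Sum>l=1..ntypes M a. ?g l * (dir a * x a l) * ?q l) \<le>
    (\<Sum>l=1..ntypes M a. ?g l * iron (ntypes M a) ?g (\<lambda>k. dir a * x a k) l * ?q l)"
  proof (rule iron_dominates)
    show "?g l > 0" if "l \<in> {1..ntypes M a}" for l
      using that pmf_pos[OF a] by (simp add: types_def)
    show "?q l \<le> ?q k" if "1 \<le> l" "l \<le> k" "k \<le> ntypes M a" for l k
    proof -
      have "l \<in> types M a" "k \<in> types M a"
        using that by (auto simp: types_def)
      then show ?thesis
        using interim_prob_mono[OF a \<open>bic M m\<close>, of l k] interim_prob_mono[OF a \<open>bic M m\<close>, of k l]
          signed_value_le[OF a, of l k] signed_value_le[OF a, of k l] \<open>l \<le> k\<close>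
        by (cases a) (auto simp: dir_def)
    qed
  qed
  then show ?thesis
    unfolding agent_welfare_eq[OF a] signed_iron_def types_def
    by (simp add: ac_simps)
qed

lemma welfare_eq_ironed_welfare:
  assumes a: "a \<in> agents M"
    and "\<And>l r. l \<in> types M a \<Longrightarrow> r \<in> types M a \<Longrightarrow>
      signed_iron M x a l = signed_iron M x a r \<Longrightarrow> interim_prob M m a l = interim_prob M m a r"
  shows "agent_welfare M m x a = agent_welfare M m (signed_iron M x) a"
proof -
  let ?g = "pmf (tdist M a)" and ?q = "\<lambda>l. dir a * interim_prob M m a l"
  have "(\<Sum>l=1..ntypes M a. ?g l * (dir a * x a l) * ?q l) =
    (\<Sum>l=1..ntypes M a. ?g l * iron (ntypes M a) ?g (\<lambda>k. dir a * x a k) l * ?q l)"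
  proof (rule iron_eq_on_level_sets)
    show "?g l > 0" if "l \<in> {1..ntypes M a}" for l
      using that pmf_pos[OF a] by (simp add: types_def)
    show "?q l = ?q k" if "l \<in> {1..ntypes M a}" "k \<in> {1..ntypes M a}"
      "iron (ntypes M a) ?g (\<lambda>k. dir a * x a k) l = iron (ntypes M a) ?g (\<lambda>k. dir a * x a k) k"
      for l k
      using assms(2)[of l k] that by (simp add: types_def signed_iron_def)
  qed
  then show ?thesis
    unfolding agent_welfare_eq[OF a] signed_iron_def types_def
    by (simp add: ac_simps)
qed

text \<open>The information rent taken off a value or added to a cost is nonnegative.\<close>

lemma signed_virtual_le:
  assumes a: "a \<in> agents M" and l: "l \<in> types M a"
  shows "signed_virtual M a l \<le> signed_value M a l"
proof (cases a)
  case (Inl i)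
  have "0 \<le> (tval M a (l + 1) - tval M a l) * ((\<Sum>r\<in>{l<..ntypes M a}. pmf (tdist M a) r) / pmf (tdist M a) l)"
    if "l < ntypes M a"
    using that l tval_le[OF a, of l "l + 1"]
    by (intro mult_nonneg_nonneg divide_nonneg_nonneg sum_nonneg) (auto simp: types_def)
  then show ?thesis
    by (auto simp: signed_virtual_def signed_value_def dir_def Inl virtual_value_def Let_def)
next
  case (Inr j)
  have "0 \<le> (tval M a l - tval M a (l - 1)) * ((\<Sum>r\<in>{1..<l}. pmf (tdist M a) r) / pmf (tdist M a) l)"
    if "l > 1"
  proof -
    have "l - 1 \<in> types M a"
      using that l unfolding types_def by simp linarith
    then show ?thesis
      using l tval_le[OF a, of "l - 1" l]
      by (intro mult_nonneg_nonneg divide_nonneg_nonneg sum_nonneg) simp_all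
  qed
  then show ?thesis
    by (auto simp: signed_virtual_def signed_value_def dir_def Inr virtual_cost_def Let_def)
qed

end

section \<open>Selected matchings\<close>

lemma finite_linear_order_least:
  assumes "finite S" "S \<noteq> {}" "S \<subseteq> A" "linear_order_on A r"
  shows "\<exists>x\<in>S. \<forall>y\<in>S. (x, y) \<in> r"
  using assms(1-3)
proof (induction rule: finite_ne_induct)
  case (singleton x)
  then show ?case
    using assms(4) by (auto simp: order_on_defs refl_on_def)
next
  case (insert x F)
  then obtain m where m: "m \<in> F" "\<forall>y\<in>F. (m, y) \<in> r"
    by auto
  have refl: "(x, x) \<in> r" and total: "(x, m) \<in> r \<or> (m, x) \<in> r" and trans: "trans r"
    using assms(4) insert.prems insert.hyps(3) m(1)
    by (auto simp: order_on_defs refl_on_def total_on_def)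
  show ?case
    using refl total m transD[OF trans] by (metis insert_iff)
qed

text \<open>Selection by one signed score for both sides; the seller sign is undone because
  \<open>score\<close> subtracts the cost.\<close>

definition select_signed ::
  "('b, 's) market \<Rightarrow> ('b \<times> 's) set rel \<Rightarrow> ('b + 's \<Rightarrow> nat \<Rightarrow> real) \<Rightarrow> ('b, 's) profile \<Rightarrow>
   ('b \<times> 's) set" where
  "select_signed M ord \<alpha> = select M ord (\<lambda>i. \<alpha> (Inl i)) (\<lambda>j k. - \<alpha> (Inr j) k)"

definition matching_score ::
  "('b, 's) market \<Rightarrow> ('b + 's \<Rightarrow> nat \<Rightarrow> real) \<Rightarrow> ('b, 's) profile \<Rightarrow> ('b \<times> 's) set \<Rightarrow> real" where
  "matching_score M \<alpha> t X = (\<Sum>a\<in>agents M. \<alpha> a (t a) * of_bool (trades X a))"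

context market
begin

lemma finite_edges: "finite (edges M)"
  using matching_market finite_subset[of "edges M" "buyers M \<times> sellers M"]
  by (auto simp: matching_market_def)

lemma feasible_subset_edges: "X \<in> feasible M \<Longrightarrow> X \<subseteq> edges M"
  using matching_market by (auto simp: matching_market_def is_matching_def)

lemma finite_feasible: "finite (feasible M)"
  using feasible_subset_edges finite_edges
  by (auto intro!: finite_subset[of "feasible M" "Pow (edges M)"])

lemma feasible_Diff: "X \<in> feasible M \<Longrightarrow> X - Y \<in> feasible M"
  using matching_market unfolding matching_market_def by (meson Diff_subset)

text \<open>In a matching every trading agent lies on exactly one edge, so sums over traders and
  sums over edges can be exchanged.\<close>

lemma sum_trading_agents:
  fixes h :: "'b + 's \<Rightarrow> real"
  assumes "X \<in> feasible M"
  shows "(\<Sum>a\<in>agents M. h a * of_bool (trades X a)) = (\<Sum>(i, j)\<in>X. h (Inl i) + h (Inr j))"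
proof -
  have fin: "finite (buyers M)" "finite (sellers M)" and inj: "inj_on fst X" "inj_on snd X"
    and sub: "X \<subseteq> buyers M \<times> sellers M"
    using matching_market assms by (auto simp: matching_market_def is_matching_def)
  have "(\<Sum>a\<in>agents M. h a * of_bool (trades X a)) =
      (\<Sum>i\<in>buyers M. h (Inl i) * of_bool (i \<in> fst ` X)) +
      (\<Sum>j\<in>sellers M. h (Inr j) * of_bool (j \<in> snd ` X))"
    unfolding agents_def using fin by (simp add: sum.Plus del: sum_mult_of_bool_eq)
  also have "(\<Sum>i\<in>buyers M. h (Inl i) * of_bool (i \<in> fst ` X)) = (\<Sum>i\<in>fst ` X. h (Inl i))"
    using fin sub by (intro sum.mono_neutral_cong_right) auto
  also have "\<dots> = (\<Sum>e\<in>X. h (Inl (fst e)))"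
    using inj by (simp add: sum.reindex)
  also have "(\<Sum>j\<in>sellers M. h (Inr j) * of_bool (j \<in> snd ` X)) = (\<Sum>j\<in>snd ` X. h (Inr j))"
    using fin sub by (intro sum.mono_neutral_cong_right) auto
  also have "\<dots> = (\<Sum>e\<in>X. h (Inr (snd e)))"
    using inj by (simp add: sum.reindex)
  finally show ?thesis
    by (simp add: sum.distrib split_beta)
qed

lemma score_eq:
  assumes "X \<in> feasible M"
  shows "score (\<lambda>i. \<alpha> (Inl i)) (\<lambda>j k. - \<alpha> (Inr j) k) t X = matching_score M \<alpha> t X"
  using sum_trading_agents[OF assms, of "\<lambda>a. \<alpha> a (t a)"]
  by (simp add: matching_score_def score_def)

text \<open>Shows that the \<open>THE\<close> in \<open>select\<close> is well defined: finiteness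
  yields a maximizer, then one of least size, then an \<open>ord\<close>-least one, which is unique
  by antisymmetry.\<close>

lemma select_in_smallest:
  assumes "linear_order_on (feasible M) ord"
  shows "select M ord bs ss t \<in> smallest (maximizers M bs ss t)"
proof -
  let ?S = "maximizers M bs ss t"
  have fin: "finite ?S"
    using finite_feasible by (simp add: maximizers_def)
  have "feasible M \<noteq> {}"
    using matching_market by (simp add: matching_market_def)
  then have "arg_min_on (\<lambda>X. - score bs ss t X) (feasible M) \<in> ?S"
    using finite_feasible arg_min_if_finite[of "feasible M" "\<lambda>X. - score bs ss t X"]
    by (auto simp: maximizers_def not_less)
  then have "?S \<noteq> {}"
    by auto
  then have "arg_min_on card ?S \<in> smallest ?S"
    using fin arg_min_if_finite[of ?S card] by (auto simp: smallest_def not_less)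
  then have "smallest ?S \<noteq> {}"
    by auto
  moreover have "smallest ?S \<subseteq> feasible M"
    by (auto simp: smallest_def maximizers_def)
  moreover from this have "finite (smallest ?S)"
    using finite_feasible by (rule finite_subset)
  ultimately obtain X where X: "X \<in> smallest ?S" "\<forall>Y\<in>smallest ?S. (X, Y) \<in> ord"
    using finite_linear_order_least[OF _ _ _ assms] by blast
  have "antisym ord"
    using assms by (simp add: order_on_defs)
  then have "select M ord bs ss t = X"
    unfolding select_def using X by (intro the_equality) (auto dest: antisymD)
  then show ?thesis
    using X by simp
qed

lemma select_signed_feasible:
  assumes "linear_order_on (feasible M) ord"
  shows "select_signed M ord \<alpha> t \<in> feasible M"
  using select_in_smallest[OF assms] by (auto simp: select_signed_def smallest_def maximizers_def)

lemma select_signed_max: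
  assumes "linear_order_on (feasible M) ord" "Y \<in> feasible M"
  shows "matching_score M \<alpha> t Y \<le> matching_score M \<alpha> t (select_signed M ord \<alpha> t)"
  using select_in_smallest[OF assms(1), of "\<lambda>i. \<alpha> (Inl i)" "\<lambda>j k. - \<alpha> (Inr j) k" t] assms
  by (auto simp: select_signed_def smallest_def maximizers_def score_eq)

text \<open>Tie-breaking does not look at the reports, so the profile matters only through the
  scores of feasible matchings.\<close>

lemma select_signed_cong:
  assumes "\<And>X. X \<in> feasible M \<Longrightarrow> matching_score M \<alpha> t X = matching_score M \<alpha> t' X"
  shows "select_signed M ord \<alpha> t = select_signed M ord \<alpha> t'"
proof -
  have "maximizers M (\<lambda>i. \<alpha> (Inl i)) (\<lambda>j k. - \<alpha> (Inr j) k) t =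
      maximizers M (\<lambda>i. \<alpha> (Inl i)) (\<lambda>j k. - \<alpha> (Inr j) k) t'"
    unfolding maximizers_def using assms by (auto simp: score_eq)
  then show ?thesis
    by (simp add: select_signed_def select_def)
qed

lemma matching_score_fun_upd:
  assumes "a \<in> agents M"
  shows "matching_score M \<alpha> (t(a := r)) X =
    matching_score M \<alpha> t X + (\<alpha> a r - \<alpha> a (t a)) * of_bool (trades X a)"
  using assms unfolding matching_score_def
  by (simp add: sum.remove[OF finite_agents assms] algebra_simps)

lemma select_signed_same_score:
  assumes "a \<in> agents M" "\<alpha> a r = \<alpha> a r'"
  shows "select_signed M ord \<alpha> (t(a := r)) = select_signed M ord \<alpha> (t(a := r'))"
  using assms by (intro select_signed_cong) (simp add: matching_score_fun_upd)

text \<open>Equal scores give the same selection. A strict increase lifts exactly the matchings in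
  which \<open>a\<close> trades, so the one selected before now strictly beats every matching that
  leaves her out.\<close>

lemma trades_mono:
  assumes ord: "linear_order_on (feasible M) ord" and a: "a \<in> agents M"
    and trades: "trades (select_signed M ord \<alpha> (t(a := r))) a" and le: "\<alpha> a r \<le> \<alpha> a r'"
  shows "trades (select_signed M ord \<alpha> (t(a := r'))) a"
proof (cases "\<alpha> a r = \<alpha> a r'")
  case True
  then show ?thesis
    using trades select_signed_same_score[where \<alpha> = \<alpha>, OF a True] by simp
next
  case False
  define X where "X = select_signed M ord \<alpha> (t(a := r))"
  define Y where "Y = select_signed M ord \<alpha> (t(a := r'))"
  have "matching_score M \<alpha> (t(a := r)) Y \<le> matching_score M \<alpha> (t(a := r)) X"
    unfolding X_def by (intro select_signed_max ord) (simp add: Y_def select_signed_feasible ord)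
  moreover have "matching_score M \<alpha> (t(a := r')) X \<le> matching_score M \<alpha> (t(a := r')) Y"
    unfolding Y_def by (intro select_signed_max ord) (simp add: X_def select_signed_feasible ord)
  ultimately have "trades Y a"
    using trades[folded X_def] le False
    by (cases "trades Y a") (auto simp: matching_score_fun_upd[OF a])
  then show ?thesis
    by (simp add: Y_def)
qed

section \<open>Welfare of feasible mechanisms\<close>

text \<open>An agent has at most one partner in a matching, so the indicators of her possible edges
  sum to the indicator that she trades.\<close>

lemma trades_prob:
  assumes X: "set_pmf p \<subseteq> feasible M" and a: "a \<in> agents M"
  shows "(case a of
      Inl i \<Rightarrow> \<Sum>j\<in>sellers M. measure_pmf.prob p {X. (i, j) \<in> X}
    | Inr j \<Rightarrow> \<Sum>i\<in>buyers M. measure_pmf.prob p {X. (i, j) \<in> X}) =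
    measure_pmf.expectation p (\<lambda>X. of_bool (trades X a))"
proof -
  have "finite (set_pmf p)"
    using X finite_feasible by (rule finite_subset)
  then have int: "integrable (measure_pmf p) (f :: _ \<Rightarrow> real)" for f
    by (rule integrable_measure_pmf_finite)
  have prob: "measure_pmf.prob p {X. e \<in> X} = measure_pmf.expectation p (\<lambda>X. of_bool (e \<in> X))" for e
  proof -
    have "(\<lambda>X. of_bool (e \<in> X)) = (indicator {X. e \<in> X} :: _ \<Rightarrow> real)"
      by (auto simp: indicator_def)
    then show ?thesis
      by simp
  qed
  have fin: "finite (buyers M)" "finite (sellers M)"
    using matching_market by (auto simp: matching_market_def)
  have matching: "inj_on fst X" "inj_on snd X" "X \<subseteq> buyers M \<times> sellers M"
    if "X \<in> set_pmf p" for X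
    using that assms matching_market by (auto simp: matching_market_def is_matching_def)
  have single: "(\<Sum>j\<in>sellers M. of_bool ((i, j) \<in> X)) = (of_bool (i \<in> fst ` X) :: real)"
    if X: "X \<in> set_pmf p" for X i
  proof (cases "i \<in> fst ` X")
    case True
    then obtain j where e: "(i, j) \<in> X"
      by (metis imageE prod.collapse)
    then have "j \<in> sellers M"
      using matching(3)[OF X] by blast
    moreover have "(i, j') \<in> X \<longleftrightarrow> j' = j" for j'
      using e inj_onD[OF matching(1)[OF X], of "(i, j')" "(i, j)"] by auto
    ultimately show ?thesis
      using True fin by (simp add: of_bool_def)
  next
    case False
    then have "(i, j) \<notin> X" for j
      by (metis image_eqI fst_conv)
    then show ?thesis
      using False by simp
  qed
  have single': "(\<Sum>i\<in>buyers M. of_bool ((i, j) \<in> X)) = (of_bool (j \<in> snd ` X) :: real)"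
    if X: "X \<in> set_pmf p" for X j
  proof (cases "j \<in> snd ` X")
    case True
    then obtain i where e: "(i, j) \<in> X"
      by (metis imageE prod.collapse)
    then have "i \<in> buyers M"
      using matching(3)[OF X] by blast
    moreover have "(i', j) \<in> X \<longleftrightarrow> i' = i" for i'
      using e inj_onD[OF matching(2)[OF X], of "(i', j)" "(i, j)"] by auto
    ultimately show ?thesis
      using True fin by (simp add: of_bool_def)
  next
    case False
    then have "(i, j) \<notin> X" for i
      by (metis image_eqI snd_conv)
    then show ?thesis
      using False by simp
  qed
  show ?thesis
  proof (cases a)
    case (Inl i)
    have "(\<Sum>j\<in>sellers M. measure_pmf.prob p {X. (i, j) \<in> X}) =
        measure_pmf.expectation p (\<lambda>X. \<Sum>j\<in>sellers M. of_bool ((i, j) \<in> X))"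
      unfolding prob by (rule Bochner_Integration.integral_sum[symmetric]) (rule int)
    also have "\<dots> = measure_pmf.expectation p (\<lambda>X. of_bool (i \<in> fst ` X))"
      by (intro integral_cong_AE AE_pmfI single) simp_all
    finally show ?thesis
      by (simp add: Inl)
  next
    case (Inr j)
    have "(\<Sum>i\<in>buyers M. measure_pmf.prob p {X. (i, j) \<in> X}) =
        measure_pmf.expectation p (\<lambda>X. \<Sum>i\<in>buyers M. of_bool ((i, j) \<in> X))"
      unfolding prob by (rule Bochner_Integration.integral_sum[symmetric]) (rule int)
    also have "\<dots> = measure_pmf.expectation p (\<lambda>X. of_bool (j \<in> snd ` X))"
      by (intro integral_cong_AE AE_pmfI single') simp_all
    finally show ?thesis
      by (simp add: Inr)
  qed
qed

lemma trade_prob_eq: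
  assumes "feasible_mechanism M m" "t \<in> profiles M" "a \<in> agents M"
  shows "trade_prob M m t a = measure_pmf.expectation (lottery m t) (\<lambda>X. of_bool (trades X a))"
  unfolding trade_prob_def edge_prob_def
  using assms by (intro trades_prob) (auto simp: feasible_mechanism_def)

lemma sum_trade_prob:
  assumes "feasible_mechanism M m" "t \<in> profiles M"
  shows "(\<Sum>a\<in>agents M. \<alpha> a (t a) * trade_prob M m t a) =
    measure_pmf.expectation (lottery m t) (matching_score M \<alpha> t)"
proof -
  have "finite (set_pmf (lottery m t))"
    using assms finite_feasible by (auto simp: feasible_mechanism_def intro: finite_subset)
  then have "integrable (measure_pmf (lottery m t)) (f :: _ \<Rightarrow> real)" for f
    by (rule integrable_measure_pmf_finite)
  then show ?thesis
    unfolding matching_score_def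
    by (simp add: trade_prob_eq[OF assms] del: sum_mult_of_bool_eq)
qed

text \<open>Pairs outside \<open>edges M\<close> have probability zero, so the sum extends to all
  buyer-seller pairs and then splits by agent.\<close>

lemma gft_eq_welfare:
  assumes "feasible_mechanism M m"
  shows "gft M m = (\<Sum>a\<in>agents M. agent_welfare M m (signed_value M) a)"
proof -
  have "(\<Sum>(i, j)\<in>edges M.
      (tval M (Inl i) (t (Inl i)) - tval M (Inr j) (t (Inr j))) * edge_prob m t i j) =
    (\<Sum>a\<in>agents M. signed_value M a (t a) * trade_prob M m t a)" if t: "t \<in> profiles M" for t
  proof -
    have fin: "finite (buyers M)" "finite (sellers M)" and sub: "edges M \<subseteq> buyers M \<times> sellers M"
      using matching_market by (auto simp: matching_market_def)
    have off: "edge_prob m t i j = 0" if "(i, j) \<notin> edges M" for i j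
      unfolding edge_prob_def measure_pmf_zero_iff
      using that t assms feasible_subset_edges by (fastforce simp: feasible_mechanism_def)
    have "(\<Sum>(i, j)\<in>edges M.
        (tval M (Inl i) (t (Inl i)) - tval M (Inr j) (t (Inr j))) * edge_prob m t i j) =
      (\<Sum>(i, j)\<in>buyers M \<times> sellers M.
        (tval M (Inl i) (t (Inl i)) - tval M (Inr j) (t (Inr j))) * edge_prob m t i j)"
      using fin sub off by (intro sum.mono_neutral_left) auto
    also have "\<dots> = (\<Sum>i\<in>buyers M. \<Sum>j\<in>sellers M. tval M (Inl i) (t (Inl i)) * edge_prob m t i j) -
        (\<Sum>i\<in>buyers M. \<Sum>j\<in>sellers M. tval M (Inr j) (t (Inr j)) * edge_prob m t i j)"
      by (simp add: sum.cartesian_product[symmetric] left_diff_distrib sum_subtractf)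
    also have "(\<Sum>i\<in>buyers M. \<Sum>j\<in>sellers M. tval M (Inr j) (t (Inr j)) * edge_prob m t i j) =
        (\<Sum>j\<in>sellers M. \<Sum>i\<in>buyers M. tval M (Inr j) (t (Inr j)) * edge_prob m t i j)"
      by (rule sum.swap)
    also have "(\<Sum>i\<in>buyers M. \<Sum>j\<in>sellers M. tval M (Inl i) (t (Inl i)) * edge_prob m t i j) -
        (\<Sum>j\<in>sellers M. \<Sum>i\<in>buyers M. tval M (Inr j) (t (Inr j)) * edge_prob m t i j) =
        (\<Sum>a\<in>agents M. signed_value M a (t a) * trade_prob M m t a)"
      unfolding agents_def using fin
      by (simp add: sum.Plus signed_value_def dir_def trade_prob_def sum_distrib_left sum_negf)
    finally show ?thesis .
  qed
  then show ?thesis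
    unfolding gft_def agent_welfare_def expect_sum[symmetric] by (intro expect_cong)
qed

lemma revenue_eq: "revenue M m = (\<Sum>a\<in>agents M. expect M (\<lambda>t. pay m t a))"
  by (simp add: revenue_def expect_sum)

end

section \<open>Threshold mechanisms\<close>

text \<open>The threshold in signed terms: a minimum on both sides, since the largest cost of a
  seller becomes the smallest signed value.\<close>

definition price ::
  "('b, 's) market \<Rightarrow> (('b, 's) profile \<Rightarrow> ('b \<times> 's) set) \<Rightarrow> ('b, 's) profile \<Rightarrow> 'b + 's \<Rightarrow> real" where
  "price M sel t a = Min {signed_value M a r | r. r \<in> types M a \<and> trades (sel (t(a := r))) a}"

text \<open>Counterpart of \<open>offer_score\<close> before ironing; for complementary sets
  \<open>A\<close> the two hybrids add up to value plus virtual value.\<close>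

definition hybrid :: "('b, 's) market \<Rightarrow> ('b + 's \<Rightarrow> bool) \<Rightarrow> 'b + 's \<Rightarrow> nat \<Rightarrow> real" where
  "hybrid M A a = (if A a then signed_value M a else signed_virtual M a)"

text \<open>The agents in \<open>A\<close> are scored by their true values, the others by their ironed virtual values:
  the generalized seller-offering mechanism has the sellers in \<open>A\<close>, the buyer-offering one the
  buyers.\<close>

definition offer_score :: "('b, 's) market \<Rightarrow> ('b + 's \<Rightarrow> bool) \<Rightarrow> 'b + 's \<Rightarrow> nat \<Rightarrow> real" where
  "offer_score M A a = (if A a then signed_value M a else signed_iron M (signed_virtual M) a)"

lemma gsom_eq:
  "gsom M ord = threshold_mechanism M (select_signed M ord (offer_score M (\<lambda>a. \<not> isl a)))"
proof -
  have "signed_iron M (signed_virtual M) (Inl i) = ironed_value M i" for i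
    by (rule ext) (simp add: signed_iron_def dir_def signed_virtual_def ironed_value_def)
  then show ?thesis
    by (simp add: gsom_def select_signed_def offer_score_def signed_value_def dir_def)
qed

lemma gbom_eq:
  "gbom M ord = threshold_mechanism M (select_signed M ord (offer_score M isl))"
proof -
  have "signed_value M (Inl i) = tval M (Inl i)" for i
    by (rule ext) (simp add: signed_value_def dir_def)
  moreover have "(\<lambda>k. - signed_iron M (signed_virtual M) (Inr j) k) = ironed_cost M j" for j
    by (rule ext) (simp add: signed_iron_def dir_def signed_virtual_def ironed_cost_def)
  ultimately show ?thesis
    by (simp add: gbom_def select_signed_def offer_score_def)
qed

lemma price_fun_upd [simp]: "price M sel (t(a := r)) a = price M sel t a"
  by (simp add: price_def)

text \<open>Monotone scores suffice for truthfulness, so the two offer mechanisms and the optimum of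
  the relaxed problem are all instances.\<close>

locale threshold = market M for M :: "('b, 's) market" +
  fixes ord :: "('b \<times> 's) set rel" and \<alpha> :: "'b + 's \<Rightarrow> nat \<Rightarrow> real"
  assumes ord: "linear_order_on (feasible M) ord"
    and score_mono: "\<And>a l r. a \<in> agents M \<Longrightarrow> l \<in> types M a \<Longrightarrow> r \<in> types M a \<Longrightarrow>
      signed_value M a l \<le> signed_value M a r \<Longrightarrow> \<alpha> a l \<le> \<alpha> a r"
begin

abbreviation "sel \<equiv> select_signed M ord \<alpha>"
abbreviation "mech \<equiv> threshold_mechanism M sel"

lemma feasible_mech: "feasible_mechanism M mech"
  using select_signed_feasible[OF ord]
  by (simp add: feasible_mechanism_def threshold_mechanism_def)

lemma trade_prob_mech:
  "t \<in> profiles M \<Longrightarrow> a \<in> agents M \<Longrightarrow> trade_prob M mech t a = of_bool (trades (sel t) a)"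
  using trade_prob_eq[OF feasible_mech, of t a] by (simp add: threshold_mechanism_def)

lemma price_le:
  "r \<in> types M a \<Longrightarrow> trades (sel (t(a := r))) a \<Longrightarrow> price M sel t a \<le> signed_value M a r"
  unfolding price_def by (rule Min_le) auto

lemma price_attained:
  assumes "r \<in> types M a" "trades (sel (t(a := r))) a"
  obtains r' where "r' \<in> types M a" "trades (sel (t(a := r'))) a"
    "price M sel t a = signed_value M a r'"
proof -
  have "price M sel t a \<in> {signed_value M a r | r. r \<in> types M a \<and> trades (sel (t(a := r))) a}"
    unfolding price_def using assms by (intro Min_in) auto
  then show thesis
    using that by auto
qed

lemma pay_mech:
  assumes "t \<in> profiles M" "a \<in> agents M"
  shows "pay mech t a = of_bool (trades (sel t) a) * price M sel t a"
proof (cases "trades (sel t) a")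
  case True
  then have ne: "trade_reports M sel t a \<noteq> {}"
    using profile_types[OF assms] by (auto simp: trade_reports_def intro!: exI[of _ "t a"])
  have fin: "finite (trade_reports M sel t a)"
    by (simp add: trade_reports_def)
  show ?thesis
  proof (cases a)
    case (Inl i)
    then show ?thesis
      using True by (simp add: threshold_mechanism_def price_def trade_reports_def signed_value_def dir_def)
  next
    case (Inr j)
    have "{signed_value M a r | r. r \<in> types M a \<and> trades (sel (t(a := r))) a} =
        uminus ` trade_reports M sel t a"
      by (auto simp: trade_reports_def signed_value_def dir_def Inr)
    then show ?thesis
      using True ne fin
      by (simp add: Inr threshold_mechanism_def price_def minus_Max_eq_Min)
  qed
next
  case False
  then show ?thesis
    by (cases a) (auto simp: threshold_mechanism_def)
qed

lemma utility_mech: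
  assumes "t \<in> profiles M" "a \<in> agents M"
  shows "utility M mech a l t = of_bool (trades (sel t) a) * (signed_value M a l - price M sel t a)"
  unfolding utility_eq trade_prob_mech[OF assms] pay_mech[OF assms] by (simp add: algebra_simps)

lemma trades_mono_value:
  assumes "a \<in> agents M" "l \<in> types M a" "r \<in> types M a"
    and "signed_value M a l \<le> signed_value M a r" "trades (sel (t(a := l))) a"
  shows "trades (sel (t(a := r))) a"
  using trades_mono[OF ord assms(1,5)] score_mono[OF assms(1-4)] by blast

text \<open>The price does not depend on the report of \<open>a\<close>. If truth trades, it yields
  value minus price, which is nonnegative; if not, monotonicity puts every trading type, and so the
  price, at or above her value.\<close>

lemma truth_optimal:
  assumes t: "t \<in> profiles M" and a: "a \<in> agents M" and l: "l \<in> types M a" and r: "r \<in> types M a"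
  shows "utility M mech a l (t(a := r)) \<le> utility M mech a l (t(a := l))"
proof -
  note util = utility_mech[OF profile_fun_upd[OF t a] a]
  consider (trade) "trades (sel (t(a := l))) a"
    | (price) "\<not> trades (sel (t(a := l))) a" "trades (sel (t(a := r))) a"
    | (no) "\<not> trades (sel (t(a := l))) a" "\<not> trades (sel (t(a := r))) a"
    by blast
  then show ?thesis
  proof cases
    case trade
    then show ?thesis
      using price_le[OF l trade] by (simp add: util l r of_bool_def)
  next
    case price
    obtain r' where r': "r' \<in> types M a" "trades (sel (t(a := r'))) a"
      "price M sel t a = signed_value M a r'"
      using price_attained[OF r price(2)] .
    then have "signed_value M a l \<le> signed_value M a r'"
      using trades_mono_value[OF a r'(1) l, of t] price(1) by force
    then show ?thesis
      using r' price by (simp add: util l r)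
  next
    case no
    then show ?thesis
      by (simp add: util l r)
  qed
qed

lemma dsic_mech: "dsic M mech"
  unfolding dsic_def using truth_optimal profile_types by (metis fun_upd_triv)

lemma ex_post_ir_mech: "ex_post_ir M mech"
  unfolding ex_post_ir_def
proof (intro ballI)
  fix a t assume a: "a \<in> agents M" and t: "t \<in> profiles M"
  then show "0 \<le> utility M mech a (t a) t"
    using price_le[OF profile_types[OF t a], of t] by (simp add: utility_mech of_bool_def)
qed

lemma bic_mech: "bic M mech"
  unfolding bic_def interim_def using truth_optimal by (auto intro!: expect_mono)

lemma iir_mech: "iir M mech"
  unfolding iir_def interim_def
proof (intro ballI)
  fix a l assume a: "a \<in> agents M" and l: "l \<in> types M a"
  have "0 \<le> utility M mech a l (t(a := l))" if t: "t \<in> profiles M" for t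
    using ex_post_ir_mech profile_fun_upd[OF t a l] a by (fastforce simp: ex_post_ir_def)
  then show "0 \<le> expect M (\<lambda>t. utility M mech a l (t(a := l)))"
    using expect_mono[of "\<lambda>_. 0" "\<lambda>t. utility M mech a l (t(a := l))"] by simp
qed

lemma worse_next:
  assumes a: "a \<in> agents M" and l: "l \<in> types M a" and r: "r \<in> types M a"
    and less: "signed_value M a r < signed_value M a l"
  shows "worse a l \<in> types M a \<and> signed_value M a r \<le> signed_value M a (worse a l)"
proof -
  have "if isl a then r < l else l < r"
    using less signed_value_le[OF a l r] by (auto split: if_splits)
  then have w: "worse a l \<in> types M a" and "if isl a then r \<le> worse a l else worse a l \<le> r"
    using l r by (cases a; force simp: worse_def types_def)+
  then show ?thesis
    using signed_value_le[OF a r w] by simp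
qed

lemma worse_le:
  assumes "a \<in> agents M" "l \<in> types M a" "worse a l \<in> types M a"
  shows "signed_value M a (worse a l) \<le> signed_value M a l"
  using signed_value_le[OF assms(1,3,2)] by (cases a) (auto simp: worse_def)

text \<open>The local constraint binds at every profile. If the next worse report trades, both
  reports trade at the same price. Otherwise a trading \<open>l\<close> is the lowest trading type
  and pays exactly her value.\<close>

lemma utility_worse:
  assumes t: "t \<in> profiles M" and a: "a \<in> agents M" and l: "l \<in> types M a"
  shows "utility M mech a l (t(a := l)) =
    (if worse a l \<in> types M a then utility M mech a l (t(a := worse a l)) else 0)"
proof -
  note util = utility_mech[OF profile_fun_upd[OF t a] a]
  let ?T = "\<lambda>r. trades (sel (t(a := r))) a"
  have least: "price M sel t a = signed_value M a l"
    if T: "?T l" and no: "worse a l \<in> types M a \<longrightarrow> \<not> ?T (worse a l)"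
  proof (rule antisym)
    show "price M sel t a \<le> signed_value M a l"
      using price_le l T by blast
    obtain r where r: "r \<in> types M a" "?T r" "price M sel t a = signed_value M a r"
      using price_attained[OF l T] .
    have "\<not> signed_value M a r < signed_value M a l"
      using worse_next[OF a l r(1)] trades_mono_value[OF a r(1) _ _ r(2)] no by blast
    then show "signed_value M a l \<le> price M sel t a"
      using r by simp
  qed
  show ?thesis
  proof (cases "worse a l \<in> types M a \<and> ?T (worse a l)")
    case True
    then have "?T l"
      using trades_mono_value[OF a _ l worse_le[OF a l]] by blast
    then show ?thesis
      using True by (simp add: util l)
  next
    case False
    then show ?thesis
      using least by (auto simp: util l)
  qed
qed

lemma expect_pay_mech:
  assumes a: "a \<in> agents M"
  shows "expect M (\<lambda>t. pay mech t a) = agent_welfare M mech (signed_virtual M) a"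
proof (rule pay_eq_virtual_welfare[OF a])
  fix l assume l: "l \<in> types M a"
  then show "interim M mech a l l =
      (if worse a l \<in> types M a then interim M mech a l (worse a l) else 0)"
    using expect_cong[of "\<lambda>t. utility M mech a l (t(a := l))"
        "\<lambda>t. if worse a l \<in> types M a then utility M mech a l (t(a := worse a l)) else 0"]
      utility_worse[OF _ a l]
    by (simp add: interim_def)
qed

text \<open>The selection cannot tell apart types of \<open>a\<close> with equal ironed scores, so
  her allocation is constant on their level sets.\<close>

lemma ironed_welfare_mech:
  assumes a: "a \<in> agents M" and score: "\<alpha> a = signed_iron M x a"
  shows "agent_welfare M mech (signed_iron M x) a = agent_welfare M mech x a"
proof (rule welfare_eq_ironed_welfare[OF a, symmetric])
  fix l r assume l: "l \<in> types M a" and r: "r \<in> types M a"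
    and eq: "signed_iron M x a l = signed_iron M x a r"
  have "sel (t(a := l)) = sel (t(a := r))" for t
    using eq by (intro select_signed_same_score a) (simp add: score)
  then show "interim_prob M mech a l = interim_prob M mech a r"
    unfolding interim_prob_def
    using l r a by (intro expect_cong) (simp add: trade_prob_mech profile_fun_upd)
qed

text \<open>The selection maximizes the score at each profile, and a lottery only averages over
  feasible matchings.\<close>

lemma welfare_le_mech:
  assumes "feasible_mechanism M m"
  shows "(\<Sum>a\<in>agents M. agent_welfare M m \<alpha> a) \<le> (\<Sum>a\<in>agents M. agent_welfare M mech \<alpha> a)"
  unfolding agent_welfare_def expect_sum[symmetric]
proof (rule expect_mono)
  fix t assume t: "t \<in> profiles M"
  have sub: "set_pmf (lottery m t) \<subseteq> feasible M"
    using assms t by (simp add: feasible_mechanism_def)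
  then have "finite (set_pmf (lottery m t))"
    using finite_feasible by (rule finite_subset)
  then have "measure_pmf.expectation (lottery m t) (matching_score M \<alpha> t) \<le>
      measure_pmf.expectation (lottery m t) (\<lambda>_. matching_score M \<alpha> t (sel t))"
    using sub select_signed_max[OF ord]
    by (intro integral_mono_AE AE_pmfI integrable_measure_pmf_finite) auto
  then show "(\<Sum>a\<in>agents M. \<alpha> a (t a) * trade_prob M m t a) \<le>
      (\<Sum>a\<in>agents M. \<alpha> a (t a) * trade_prob M mech t a)"
    unfolding sum_trade_prob[OF assms t] sum_trade_prob[OF feasible_mech t]
    by (simp add: threshold_mechanism_def)
qed

text \<open>When \<open>a\<close> reports the worst type with which she still trades, the matching \<open>X\<close> stays optimal,
  so dropping the edge of \<open>a\<close> cannot increase the score.\<close>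

lemma pay_covers_partner:
  assumes t: "t \<in> profiles M" and ij: "(i, j) \<in> sel t"
    and ab: "a = Inl i \<and> b = Inr j \<or> a = Inr j \<and> b = Inl i"
    and true_score: "\<And>l. l \<in> types M a \<Longrightarrow> \<alpha> a l = signed_value M a l"
  shows "0 \<le> pay mech t a + \<alpha> b (t b)"
proof -
  define X where "X = sel t"
  have X: "X \<in> feasible M"
    unfolding X_def by (rule select_signed_feasible[OF ord])
  have "X \<subseteq> buyers M \<times> sellers M"
    using feasible_subset_edges[OF X] matching_market unfolding matching_market_def by blast
  then have "i \<in> buyers M" "j \<in> sellers M"
    using ij[folded X_def] by auto
  then have a: "a \<in> agents M"
    using ab by (auto simp: agents_def)
  have T: "trades X a"
    using ij ab by (force simp: X_def)
  then obtain r where r: "r \<in> types M a" "trades (sel (t(a := r))) a"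
    "price M sel t a = signed_value M a r"
    using price_attained[OF profile_types[OF t a], of t] by (auto simp: X_def)
  define t' where "t' = t(a := r)"
  \<comment> \<open>Agent \<open>a\<close> trades in both \<open>X\<close> and
    \<open>sel t'\<close>, so her change of report shifts both scores equally and optimality of
    \<open>X\<close> carries over from \<open>t\<close> to \<open>t'\<close>.\<close>
  have max: "matching_score M \<alpha> t' Y \<le> matching_score M \<alpha> t' X" if Y: "Y \<in> feasible M" for Y
  proof -
    have "matching_score M \<alpha> t' Y \<le> matching_score M \<alpha> t' (sel t')"
      by (rule select_signed_max[OF ord Y])
    also have "\<dots> = matching_score M \<alpha> t (sel t') + (\<alpha> a r - \<alpha> a (t a))"
      using r by (simp add: t'_def matching_score_fun_upd[OF a])
    also have "\<dots> \<le> matching_score M \<alpha> t X + (\<alpha> a r - \<alpha> a (t a))"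
      using select_signed_max[OF ord select_signed_feasible[OF ord]] by (simp add: X_def)
    also have "\<dots> = matching_score M \<alpha> t' X"
      using T by (simp add: t'_def matching_score_fun_upd[OF a])
    finally show ?thesis .
  qed
  have fin: "finite X"
    using X feasible_subset_edges finite_edges by (blast intro: finite_subset)
  have "matching_score M \<alpha> t' X = matching_score M \<alpha> t' (X - {(i, j)}) +
      (\<alpha> (Inl i) (t' (Inl i)) + \<alpha> (Inr j) (t' (Inr j)))"
    unfolding matching_score_def sum_trading_agents[OF X, of "\<lambda>a. \<alpha> a (t' a)"]
      sum_trading_agents[OF feasible_Diff[OF X], of "\<lambda>a. \<alpha> a (t' a)"]
    using sum.remove[OF fin ij[folded X_def], of "\<lambda>(i, j). \<alpha> (Inl i) (t' (Inl i)) + \<alpha> (Inr j) (t' (Inr j))"]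
    by simp
  then have "0 \<le> \<alpha> (Inl i) (t' (Inl i)) + \<alpha> (Inr j) (t' (Inr j))"
    using max[OF feasible_Diff[OF X, of "{(i, j)}"]] by simp
  then have "0 \<le> \<alpha> a r + \<alpha> b (t b)"
    using ab by (auto simp: t'_def)
  then show ?thesis
    using T r true_score by (simp add: pay_mech[OF t a] X_def)
qed

end

section \<open>The offer mechanisms and the optimum of the relaxed problem\<close>

lemma (in market) threshold_offer:
  assumes "linear_order_on (feasible M) ord"
  shows "threshold M ord (offer_score M A)"
proof unfold_locales
  fix a l r
  assume "a \<in> agents M" "l \<in> types M a" "r \<in> types M a"
    and "signed_value M a l \<le> signed_value M a r"
  then show "offer_score M A a l \<le> offer_score M A a r"
    using signed_iron_mono[of a l r] by (simp add: offer_score_def)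
qed (rule assms)

lemma (in market) wbb_offer:
  assumes ord: "linear_order_on (feasible M) ord" and A: "\<And>i j. A (Inl i) \<longleftrightarrow> \<not> A (Inr j)"
  shows "ex_ante_wbb M (threshold_mechanism M (select_signed M ord (offer_score M A)))"
proof -
  interpret threshold M ord "offer_score M A"
    by (rule threshold_offer[OF ord])
  \<comment> \<open>For agents outside \<open>A\<close> the payment is replaced by the ironed
    virtual score, which has the same expectation over their trades; the sum is then nonnegative at
    each profile, edge by edge.\<close>
  define h where "h t a = (if A a then pay mech t a else offer_score M A a (t a))" for t a
  have "expect M (\<lambda>t. pay mech t a) = expect M (\<lambda>t. h t a * of_bool (trades (sel t) a))"
    if a: "a \<in> agents M" for a
  proof (cases "A a")
    case True
    then show ?thesis
      by (intro expect_cong) (simp add: h_def pay_mech a)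
  next
    case False
    then have "expect M (\<lambda>t. pay mech t a) =
        agent_welfare M mech (signed_iron M (signed_virtual M)) a"
      using ironed_welfare_mech[OF a, of "signed_virtual M"] expect_pay_mech[OF a]
      by (simp add: offer_score_def)
    then show ?thesis
      unfolding agent_welfare_def using False a
      by (simp add: h_def offer_score_def trade_prob_mech cong: expect_cong)
  qed
  then have "revenue M mech = expect M (\<lambda>t. \<Sum>a\<in>agents M. h t a * of_bool (trades (sel t) a))"
    unfolding revenue_eq expect_sum by (intro sum.cong) auto
  moreover have "0 \<le> (\<Sum>a\<in>agents M. h t a * of_bool (trades (sel t) a))"
    if t: "t \<in> profiles M" for t
  proof -
    have "0 \<le> h t (Inl i) + h t (Inr j)" if ij: "(i, j) \<in> sel t" for i j
    proof (cases "A (Inl i)")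
      case True
      then show ?thesis
        using pay_covers_partner[OF t ij, of "Inl i" "Inr j"] A[of i j]
        by (simp add: h_def offer_score_def)
    next
      case False
      then show ?thesis
        using pay_covers_partner[OF t ij, of "Inr j" "Inl i"] A[of i j]
        by (simp add: h_def offer_score_def)
    qed
    then show ?thesis
      unfolding sum_trading_agents[OF select_signed_feasible[OF ord]]
      by (intro sum_nonneg) auto
  qed
  ultimately show ?thesis
    unfolding ex_ante_wbb_def
    using expect_mono[of "\<lambda>_. 0" "\<lambda>t. \<Sum>a\<in>agents M. h t a * of_bool (trades (sel t) a)"] by simp
qed

lemma (in market) agent_welfare_add:
  "agent_welfare M m (\<lambda>a l. x a l + y a l) a = agent_welfare M m x a + agent_welfare M m y a"
  by (simp add: agent_welfare_def distrib_right)

text \<open>BIC makes the allocation of \<open>m\<close> monotone, so ironing only raises its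
  welfare and the selection raises it further. On the selected allocation ironing is free, and
  virtual values are at most true ones.\<close>

lemma (in market) gft_offer:
  assumes ord: "linear_order_on (feasible M) ord" and m: "feasible_mechanism M m" "bic M m"
  shows "(\<Sum>a\<in>agents M. agent_welfare M m (hybrid M A) a) \<le>
    gft M (threshold_mechanism M (select_signed M ord (offer_score M A)))"
proof -
  interpret threshold M ord "offer_score M A"
    by (rule threshold_offer[OF ord])
  have "agent_welfare M m (hybrid M A) a \<le> agent_welfare M m (offer_score M A) a"
    if a: "a \<in> agents M" for a
  proof (cases "A a")
    case True
    then show ?thesis
      by (simp add: agent_welfare_def hybrid_def offer_score_def)
  next
    case False
    then show ?thesis
      using welfare_le_ironed_welfare[OF a m(2), of "signed_virtual M"]
      by (simp add: agent_welfare_def hybrid_def offer_score_def)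
  qed
  then have "(\<Sum>a\<in>agents M. agent_welfare M m (hybrid M A) a) \<le>
      (\<Sum>a\<in>agents M. agent_welfare M m (offer_score M A) a)"
    by (rule sum_mono)
  also have "\<dots> \<le> (\<Sum>a\<in>agents M. agent_welfare M mech (offer_score M A) a)"
    by (rule welfare_le_mech[OF m(1)])
  also have "\<dots> \<le> (\<Sum>a\<in>agents M. agent_welfare M mech (signed_value M) a)"
  proof (rule sum_mono)
    fix a assume a: "a \<in> agents M"
    show "agent_welfare M mech (offer_score M A) a \<le> agent_welfare M mech (signed_value M) a"
    proof (cases "A a")
      case True
      then show ?thesis
        by (simp add: agent_welfare_def offer_score_def)
    next
      case False
      then have "agent_welfare M mech (offer_score M A) a =
          agent_welfare M mech (signed_virtual M) a"
        using ironed_welfare_mech[OF a, of "signed_virtual M"]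
        by (simp add: agent_welfare_def offer_score_def)
      also have "\<dots> \<le> agent_welfare M mech (signed_value M) a"
        unfolding agent_welfare_def using signed_virtual_le[OF a] profile_types a
        by (intro expect_mono mult_right_mono) (auto simp: trade_prob_mech)
      finally show ?thesis .
    qed
  qed
  also have "\<dots> = gft M mech"
    by (rule gft_eq_welfare[OF feasible_mech, symmetric])
  finally show ?thesis .
qed

text \<open>Ironing the sum of value and virtual value, rather than the virtual value alone, gives a
  mechanism that attains the relaxed upper bound.\<close>

lemma (in market) is_V1_threshold:
  assumes ord: "linear_order_on (feasible M) ord"
  defines "x \<equiv> \<lambda>a l. signed_value M a l + signed_virtual M a l"
  defines "m \<equiv> threshold_mechanism M (select_signed M ord (signed_iron M x))"
  shows "is_V1 M (\<Sum>a\<in>agents M. agent_welfare M m x a)"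
    and "feasible_mechanism M m" "bic M m"
proof -
  interpret threshold M ord "signed_iron M x"
    by unfold_locales (rule ord, rule signed_iron_mono)
  show m: "feasible_mechanism M m" "bic M m"
    unfolding m_def by (rule feasible_mech bic_mech)+
  have "gft M m + revenue M m = (\<Sum>a\<in>agents M. agent_welfare M m x a)"
    unfolding gft_eq_welfare[OF m(1)] revenue_eq x_def agent_welfare_add
    by (simp add: sum.distrib m_def expect_pay_mech)
  moreover have "gft M m' + revenue M m' \<le> (\<Sum>a\<in>agents M. agent_welfare M m x a)"
    if m': "feasible_mechanism M m'" "bic M m'" "iir M m'" for m'
  proof -
    have "gft M m' + revenue M m' \<le> (\<Sum>a\<in>agents M. agent_welfare M m' x a)"
      unfolding gft_eq_welfare[OF m'(1)] revenue_eq x_def agent_welfare_add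
      by (simp add: sum.distrib sum_mono pay_le_virtual_welfare m')
    also have "\<dots> \<le> (\<Sum>a\<in>agents M. agent_welfare M m' (signed_iron M x) a)"
      by (intro sum_mono welfare_le_ironed_welfare m')
    also have "\<dots> \<le> (\<Sum>a\<in>agents M. agent_welfare M m (signed_iron M x) a)"
      unfolding m_def by (rule welfare_le_mech[OF m'(1)])
    also have "\<dots> = (\<Sum>a\<in>agents M. agent_welfare M m x a)"
      unfolding m_def by (intro sum.cong ironed_welfare_mech) auto
    finally show ?thesis .
  qed
  ultimately show "is_V1 M (\<Sum>a\<in>agents M. agent_welfare M m x a)"
    unfolding is_V1_def using m iir_mech by (auto simp: m_def)
qed

theorem lemmaD2:
  fixes M :: "('b, 's) market"
    and rs rb :: "('b \<times> 's) set rel"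
  assumes "matching_market M"
    and "linear_order_on (feasible M) rs"
    and "linear_order_on (feasible M) rb"
  shows "(dsic M (gsom M rs) \<and> ex_post_ir M (gsom M rs) \<and> ex_ante_wbb M (gsom M rs)) \<and>
         (dsic M (gbom M rb) \<and> ex_post_ir M (gbom M rb) \<and> ex_ante_wbb M (gbom M rb)) \<and>
         (\<exists>V1. is_V1 M V1 \<and> 2 * G_offer M rs rb \<ge> V1)"
proof -
  interpret market M
    by unfold_locales (rule assms(1))
  interpret S: threshold M rs "offer_score M (\<lambda>a. \<not> isl a)"
    by (rule threshold_offer[OF assms(2)])
  interpret B: threshold M rb "offer_score M isl"
    by (rule threshold_offer[OF assms(3)])
  define x where "x a l = signed_value M a l + signed_virtual M a l" for a l
  \<comment> \<open>\<open>rs\<close> also breaks ties for the optimum. As \<open>gft_offer\<close>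
    compares with any feasible BIC mechanism, the same \<open>m\<close> serves for GBOM with its own
    order \<open>rb\<close>.\<close>
  define m where "m = threshold_mechanism M (select_signed M rs (signed_iron M x))"
  have V1: "is_V1 M (\<Sum>a\<in>agents M. agent_welfare M m x a)"
    and m: "feasible_mechanism M m" "bic M m"
    using is_V1_threshold[OF assms(2)] by (simp_all add: m_def x_def[abs_def])
  \<comment> \<open>Each agent is truthfully scored in exactly one of the two mechanisms, so the
    hybrids contribute her value once and her virtual value once.\<close>
  have "x = (\<lambda>a l. hybrid M (\<lambda>a. \<not> isl a) a l + hybrid M isl a l)"
    by (intro ext) (simp add: x_def hybrid_def)
  then have "(\<Sum>a\<in>agents M. agent_welfare M m x a) \<le> gft M (gsom M rs) + gft M (gbom M rb)"
    using gft_offer[OF assms(2) m, of "\<lambda>a. \<not> isl a"] gft_offer[OF assms(3) m, of isl]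
    by (simp add: agent_welfare_add sum.distrib gsom_eq gbom_eq)
  also have "\<dots> = 2 * G_offer M rs rb"
    by (simp add: G_offer_def)
  finally have "is_V1 M (\<Sum>a\<in>agents M. agent_welfare M m x a) \<and>
      (\<Sum>a\<in>agents M. agent_welfare M m x a) \<le> 2 * G_offer M rs rb"
    using V1 by simp
  then show ?thesis
    using S.dsic_mech S.ex_post_ir_mech wbb_offer[OF assms(2), of "\<lambda>a. \<not> isl a"]
      B.dsic_mech B.ex_post_ir_mech wbb_offer[OF assms(3), of isl]
    by (auto simp: gsom_eq gbom_eq)
qed

end
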